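(* Let $\alpha \in \mathbb{R} \setminus \mathbb{Q}$ and let $\{m_l\}_{l\in\mathbb{N}}$ be a sequence of integers such that $\lim_{l\to\infty} \|m_l \alpha\| = 0$. Then there exists a weakly mixing dynamical system $(T, M, m)$ (on a probability space without atoms) such that $\{m_l\}_{l\in\mathbb{N}}$ is a rigidity sequence for $(T, M, m)$.
   Context: For $x \in \mathbb{R}$, $\|x\| := \inf_{n \in \mathbb{Z}} |x - n|$ is the distance from $x$ to the nearest integer. A dynamical system $(T,M,m)$ is an invertible measure-preserving transformation $T$ of a standard probability space $(M,m)$. A sequence of integers $\{m_l\}$ is a rigidity sequence for $(T,M,m)$ if $m(T^{m_l}A \,\triangle\, A) \to 0$ as $l \to \infty$ for every measurable set $A \subset M$ (equivalently, $f\circ T^{m_l} \to f$ in $L^2(m)$ for every $f \in L^2(m)$). The system is weakly mixing if $T \times T$ is ergodic for $m \times m$ (equivalently, the only eigenfunctions in $L^2(m)$ of the operator $f\mapsto f\circ T$ are the constants). *)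

theory Defs
  imports "HOL-Probability.Probability"
begin

definition dist_int :: "real \<Rightarrow> real" where
  "dist_int x = (INF n::int. \<bar>x - of_int n\<bar>)"

(* A probability measure on the Borel sets of a Polish (separable, completely metrizable) space.
   The measure is not assumed to be complete. *)
definition standard_prob_space :: "'a measure \<Rightarrow> bool" where
  "standard_prob_space M \<longleftrightarrow> prob_space M \<and>
     (\<exists>X :: 'a topology. completely_metrizable_space X \<and> second_countable X \<and>
        topspace X = space M \<and> sets M = sigma_sets (topspace X) {U. openin X U})"

definition atomless :: "'a measure \<Rightarrow> bool" where
  "atomless M \<longleftrightarrow> (\<forall>A\<in>sets M. measure M A > 0 \<longrightarrow>
     (\<exists>B\<in>sets M. B \<subseteq> A \<and> 0 < measure M B \<and> measure M B < measure M A))"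

(* Only the restriction of T to space M matters, here and below. *)
definition dynamical_system :: "('a \<Rightarrow> 'a) \<Rightarrow> 'a measure \<Rightarrow> bool" where
  "dynamical_system T M \<longleftrightarrow> standard_prob_space M \<and>
     T \<in> measurable M M \<and> bij_betw T (space M) (space M) \<and>
     inv_into (space M) T \<in> measurable M M \<and> distr M M T = M"

definition int_iterate :: "('a \<Rightarrow> 'a) \<Rightarrow> 'a measure \<Rightarrow> int \<Rightarrow> 'a \<Rightarrow> 'a" where
  "int_iterate T M k = (if k \<ge> 0 then T ^^ nat k else inv_into (space M) T ^^ nat (- k))"

definition rigidity_sequence :: "(nat \<Rightarrow> int) \<Rightarrow> ('a \<Rightarrow> 'a) \<Rightarrow> 'a measure \<Rightarrow> bool" where
  "rigidity_sequence m T M \<longleftrightarrow>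
     (\<forall>A\<in>sets M. (\<lambda>l. measure M (sym_diff (int_iterate T M (m l) ` A) A)) \<longlonglongrightarrow> 0)"

definition ergodic :: "('a \<Rightarrow> 'a) \<Rightarrow> 'a measure \<Rightarrow> bool" where
  "ergodic T M \<longleftrightarrow> (\<forall>A\<in>sets M. T -` A \<inter> space M = A \<longrightarrow> measure M A = 0 \<or> measure M A = 1)"

definition weakly_mixing :: "('a \<Rightarrow> 'a) \<Rightarrow> 'a measure \<Rightarrow> bool" where
  "weakly_mixing T M \<longleftrightarrow> ergodic (map_prod T T) (M \<Otimes>\<^sub>M M)"

end

theory Submission
  imports Defs
begin

text \<open>
The system is the shift on a stationary Gaussian process \<open>(X n)\<close> with covariance
\<open>E (X m * X n) = r (m - n)\<close>, where \<open>r n\<close> is the real part of the \<open>n\<close>-th Fourier coefficient of a suitable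
law of a random point \<open>\<theta>\<close> on the circle. Since the joint law of a Gaussian family is determined by its
covariances, the dynamical properties can be read off from \<open>r\<close>. If \<open>r (n + m l) \<longlonglongrightarrow> r n\<close> for every \<open>n\<close>,
the pairs of the process and its translates by \<open>m l\<close> converge in law to the diagonal coupling, which
is rigidity. If \<open>r (n + k j) \<longlonglongrightarrow> 0\<close> for every \<open>n\<close> along some sequence of times \<open>k j\<close>, the process becomes
independent of its translates by \<open>k j\<close>; such mixing along a sequence is inherited by the product of the
system with itself and makes it ergodic.

It remains to find a law with these two properties. Take \<open>\<theta> = (\<Sum>i. \<epsilon> i * x i)\<close>, where the \<open>x i\<close> are
tiny integer combinations of \<open>\<alpha>\<close> and \<open>1\<close> and the \<open>\<epsilon> i \<in> {0, 1}\<close> are independent with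
\<open>P (\<epsilon> i = 1) = 1 / (i + 2)\<close>. For each \<open>i\<close> the distance of \<open>m l * x i\<close> to the integers tends to zero. By
choosing the \<open>x i\<close> successively, each small enough in terms of the earlier ones, one can arrange that for
every \<open>l\<close> at most one \<open>i\<close> has \<open>m l * x i\<close> at a distance from the integers that is not exponentially small in \<open>i\<close>.
That index tends to infinity with \<open>l\<close>, and its contribution is harmless because
\<open>P (\<epsilon> i = 1)\<close> tends to zero (\<open>charfun_rigid\<close>, \<open>frequency_sequence_exists\<close>). On the other hand
\<open>\<Sum>i. P (\<epsilon> i = 1)\<close> diverges: at a time that moves a long block of the \<open>x i\<close> close to one half modulo one
simultaneously, the Fourier coefficient, a product over \<open>i\<close>, is close to zero (\<open>charfun_decay\<close>).

The passage from covariances to measures of sets uses a continuity theorem for families of random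
variables (\<open>orthant_probability_convergence\<close>), reduced to Levy's theorem on the line, and a Dynkin
argument (\<open>joint_convergence_from_generator\<close>). Gaussian laws with given covariance come from an
infinite Cholesky factorization (\<open>gram_factorization\<close>).
\<close>

section \<open>A continuity theorem for families of random variables\<close>

text \<open>Reweighting a probability measure by a bounded density \<open>w\<close> and pushing it forward along \<open>Y\<close>
turns weighted integrals of trigonometric functions of \<open>Y\<close> into values of a genuine characteristic
function, so that the one-dimensional theorem of Levy applies to them.\<close>
lemma tilted_law:
  fixes w Y :: "'a \<Rightarrow> real"
  assumes M: "prob_space M"
    and [measurable]: "w \<in> borel_measurable M" "Y \<in> borel_measurable M"
    and w: "\<And>x. 0 \<le> w x" "\<And>x. w x \<le> B"
    and pos: "0 < (\<integral>x. w x \<partial>M)"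
  defines "N \<equiv> distr (density M (\<lambda>x. ennreal (w x / (\<integral>x. w x \<partial>M)))) borel Y"
  shows "real_distribution N"
    and "char N t = ((\<integral>x. w x * cos (t * Y x) \<partial>M) + \<i> * (\<integral>x. w x * sin (t * Y x) \<partial>M)) / (\<integral>x. w x \<partial>M)"
    and "cdf N a = (\<integral>x. w x * indicator {..a} (Y x) \<partial>M) / (\<integral>x. w x \<partial>M)"
proof -
  interpret prob_space M by fact
  define m where "m = (\<integral>x. w x \<partial>M)"
  have m: "m > 0" using pos by (simp add: m_def)
  have bounded: "integrable M (\<lambda>x. w x * f (Y x))"
    if "f \<in> borel_measurable borel" "\<And>y. \<bar>f y\<bar> \<le> 1" for f :: "real \<Rightarrow> real"
  proof (rule integrable_const_bound[where B=B])
    have "norm (w x * f (Y x)) \<le> B" for x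
      using mult_left_mono[OF that(2)[of "Y x"] w(1)[of x]] w(1)[of x] w(2)[of x] by (simp add: abs_mult)
    then show "AE x in M. norm (w x * f (Y x)) \<le> B" by simp
  qed (use that(1) in measurable)
  have integral_Re_Im: "(\<integral>x. complex_of_real (g x) + \<i> * complex_of_real (h x) \<partial>M) =
      complex_of_real (\<integral>x. g x \<partial>M) + \<i> * complex_of_real (\<integral>x. h x \<partial>M)"
    if "integrable M g" "integrable M h" for g h :: "'a \<Rightarrow> real"
    using that by (subst Bochner_Integration.integral_add) simp_all
  have w_int: "integrable M w" using bounded[of "\<lambda>_. 1"] by simp
  have "emeasure (density M (\<lambda>x. ennreal (w x / m))) (space M) = (\<integral>\<^sup>+x. ennreal (w x / m) \<partial>M)"
    by (subst emeasure_density) (auto intro!: nn_integral_cong)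
  also have "\<dots> = ennreal (\<integral>x. w x / m \<partial>M)"
    using w m w_int by (intro nn_integral_eq_integral) auto
  also have "(\<integral>x. w x / m \<partial>M) = 1"
    using m by (simp add: m_def)
  finally have "prob_space (density M (\<lambda>x. ennreal (w x / m)))"
    by (intro prob_spaceI) simp
  then show rd: "real_distribution N"
    unfolding N_def m_def[symmetric]
    by (auto intro!: prob_space.prob_space_distr simp: real_distribution_def real_distribution_axioms_def)
  have "char N t = (\<integral>x. (w x / m) *\<^sub>R iexp (t * Y x) \<partial>M)"
    unfolding N_def char_def m_def[symmetric]
    using w m by (simp add: integral_distr integral_density)
  also have "\<dots> = (\<integral>x. complex_of_real (w x * cos (t * Y x) / m) + \<i> * complex_of_real (w x * sin (t * Y x) / m) \<partial>M)"
    by (intro Bochner_Integration.integral_cong refl)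
       (simp add: Re_exp Im_exp complex_eq_iff)
  also have "\<dots> = complex_of_real (\<integral>x. w x * cos (t * Y x) / m \<partial>M) + \<i> * complex_of_real (\<integral>x. w x * sin (t * Y x) / m \<partial>M)"
    using bounded[of "\<lambda>y. cos (t * y)"] bounded[of "\<lambda>y. sin (t * y)"]
    by (intro integral_Re_Im integrable_divide_zero) auto
  finally show "char N t = ((\<integral>x. w x * cos (t * Y x) \<partial>M) + \<i> * (\<integral>x. w x * sin (t * Y x) \<partial>M)) / (\<integral>x. w x \<partial>M)"
    unfolding m_def[symmetric] by (simp add: add_divide_distrib)
  interpret N: real_distribution N by fact
  have "cdf N a = (\<integral>x. indicator {..a} x \<partial>N)"
    by (simp add: cdf_def)
  also have "\<dots> = (\<integral>x. (w x / m) *\<^sub>R indicator {..a} (Y x) \<partial>M)"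
    unfolding N_def m_def[symmetric]
    using w m by (subst integral_distr, simp, simp, subst integral_density) auto
  finally show "cdf N a = (\<integral>x. w x * indicator {..a} (Y x) \<partial>M) / (\<integral>x. w x \<partial>M)"
    unfolding m_def[symmetric] by simp
qed

text \<open>Levy's continuity theorem for the tilted laws. The total masses of the weights converge as well,
which settles the degenerate case of a limit of mass zero by domination.\<close>
lemma weighted_cdf_convergence:
  fixes w Y :: "nat \<Rightarrow> 'a \<Rightarrow> real" and w' Y' :: "'b \<Rightarrow> real"
  assumes M: "prob_space M" and M': "prob_space M'"
    and meas: "\<And>j. w j \<in> borel_measurable M" "\<And>j. Y j \<in> borel_measurable M"
      "w' \<in> borel_measurable M'" "Y' \<in> borel_measurable M'"
    and w: "\<And>j x. 0 \<le> w j x" "\<And>j x. w j x \<le> B" "\<And>x. 0 \<le> w' x" "\<And>x. w' x \<le> B"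
    and conv: "\<And>u t. (\<lambda>j. \<integral>x. w j x * cos (u + t * Y j x) \<partial>M) \<longlonglongrightarrow> (\<integral>x. w' x * cos (u + t * Y' x) \<partial>M')"
    and atomless: "measure M' {x\<in>space M'. Y' x = a} = 0"
  shows "(\<lambda>j. \<integral>x. w j x * indicator {..a} (Y j x) \<partial>M) \<longlonglongrightarrow> (\<integral>x. w' x * indicator {..a} (Y' x) \<partial>M')"
proof -
  interpret M: prob_space M by fact
  interpret M': prob_space M' by fact
  note [measurable] = meas
  have mass: "(\<lambda>j. \<integral>x. w j x \<partial>M) \<longlonglongrightarrow> (\<integral>x. w' x \<partial>M')"
    using conv[of 0 0] by simp
  have w_int: "integrable M (w j)" "integrable M' w'" for j
    using w by (auto intro!: M.integrable_const_bound[where B=B] M'.integrable_const_bound[where B=B])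
  have wi_int: "integrable M (\<lambda>x. w j x * indicator {..a} (Y j x))"
    "integrable M' (\<lambda>x. w' x * indicator {..a} (Y' x))" for j
    by (auto intro!: Bochner_Integration.integrable_bound[OF w_int(1)[of j]]
       Bochner_Integration.integrable_bound[OF w_int(2)] split: split_indicator)
  have le_mass: "(\<integral>x. w j x * indicator {..a} (Y j x) \<partial>M) \<le> (\<integral>x. w j x \<partial>M)"
    "(\<integral>x. w' x * indicator {..a} (Y' x) \<partial>M') \<le> (\<integral>x. w' x \<partial>M')" for j
    using w w_int wi_int by (auto intro!: integral_mono split: split_indicator)
  have nonneg: "0 \<le> (\<integral>x. w j x * indicator {..a} (Y j x) \<partial>M)"
    "0 \<le> (\<integral>x. w' x * indicator {..a} (Y' x) \<partial>M')" for j
    using w by auto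
  show ?thesis
  proof (cases "(\<integral>x. w' x \<partial>M') = 0")
    case True
    then have "(\<integral>x. w' x * indicator {..a} (Y' x) \<partial>M') = 0"
      using le_mass nonneg by (simp add: order_antisym)
    moreover have "(\<lambda>j. \<integral>x. w j x * indicator {..a} (Y j x) \<partial>M) \<longlonglongrightarrow> 0"
      by (rule tendsto_sandwich[OF _ _ tendsto_const mass[unfolded True]]) (use le_mass nonneg in simp_all)
    ultimately show ?thesis by simp
  next
    case False
    then have pos': "0 < (\<integral>x. w' x \<partial>M')"
      using le_mass(2) nonneg(2) by linarith
    \<comment> \<open>The tilted laws exist only once the total mass is positive, hence the shift of the index by \<open>N\<close>.\<close>
    from order_tendstoD(1)[OF mass this] obtain N where
      pos: "\<And>j. 0 < (\<integral>x. w (j + N) x \<partial>M)"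
      unfolding eventually_sequentially by (metis le_add2)
    define \<nu> where "\<nu> = (\<lambda>j. distr (density M (\<lambda>x. ennreal (w (j + N) x / (\<integral>x. w (j + N) x \<partial>M)))) borel (Y (j + N)))"
    define \<nu>' where "\<nu>' = distr (density M' (\<lambda>x. ennreal (w' x / (\<integral>x. w' x \<partial>M')))) borel Y'"
    note law' = tilted_law[OF M' meas(3,4) w(3,4) pos', folded \<nu>'_def]
    have law1: "real_distribution (\<nu> j)" for j
      using tilted_law(1)[OF M meas(1,2) w(1,2) pos] by (simp add: \<nu>_def)
    have law2: "char (\<nu> j) t = ((\<integral>x. w (j+N) x * cos (t * Y (j+N) x) \<partial>M) + \<i> * (\<integral>x. w (j+N) x * sin (t * Y (j+N) x) \<partial>M)) / (\<integral>x. w (j+N) x \<partial>M)" for j t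
      using tilted_law(2)[OF M meas(1,2) w(1,2) pos] by (simp add: \<nu>_def)
    have law3: "cdf (\<nu> j) a = (\<integral>x. w (j+N) x * indicator {..a} (Y (j+N) x) \<partial>M) / (\<integral>x. w (j+N) x \<partial>M)" for j
      using tilted_law(3)[OF M meas(1,2) w(1,2) pos] by (simp add: \<nu>_def)
    have shift: "(\<lambda>j. f (j + N)) \<longlonglongrightarrow> l \<longleftrightarrow> f \<longlonglongrightarrow> l" for f :: "nat \<Rightarrow> real" and l
      using LIMSEQ_ignore_initial_segment LIMSEQ_offset by blast
    have massN: "(\<lambda>j. \<integral>x. w (j+N) x \<partial>M) \<longlonglongrightarrow> (\<integral>x. w' x \<partial>M')"
      using mass by (subst shift)
    have "weak_conv_m \<nu> \<nu>'"
    proof (rule levy_continuity)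
      fix t
      have "(\<lambda>j. \<integral>x. w (j+N) x * cos (t * Y (j+N) x) \<partial>M) \<longlonglongrightarrow> (\<integral>x. w' x * cos (t * Y' x) \<partial>M')"
        using conv[of 0 t] by (subst shift) simp
      moreover have "(\<lambda>j. \<integral>x. w (j+N) x * sin (t * Y (j+N) x) \<partial>M) \<longlonglongrightarrow> (\<integral>x. w' x * sin (t * Y' x) \<partial>M')"
      proof -
        have *: "cos (- (pi/2) + z) = sin z" for z :: real
          by (simp only: cos_add) simp
        show ?thesis
          \<comment> \<open>The phase turns the cosine into a sine.\<close>
          using conv[of "- (pi/2)" t] unfolding * by (subst shift)
      qed
      ultimately show "(\<lambda>n. char (\<nu> n) t) \<longlonglongrightarrow> char \<nu>' t"
        unfolding law2 law'(2) using massN False by (intro tendsto_intros) auto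
    qed (fact law1 law'(1))+
    moreover have "isCont (cdf \<nu>') a"
    proof -
      interpret \<nu>': real_distribution \<nu>' by (rule law')
      have "AE x in M'. Y' x \<noteq> a"
        using atomless by (intro AE_I[of _ _ "{x\<in>space M'. Y' x = a}"]) (auto simp: M'.emeasure_eq_measure)
      then have "emeasure \<nu>' {a} = 0"
        unfolding \<nu>'_def
        by (simp add: emeasure_distr emeasure_density)
           (rule nn_integral_0_iff_AE[THEN iffD2], measurable, auto elim!: eventually_mono simp: indicator_def)
      then show ?thesis
        by (simp add: \<nu>'.isCont_cdf measure_def)
    qed
    ultimately have "(\<lambda>j. cdf (\<nu> j) a) \<longlonglongrightarrow> cdf \<nu>' a"
      by (auto simp: weak_conv_m_def weak_conv_def)
    then have "(\<lambda>j. cdf (\<nu> j) a * (\<integral>x. w (j+N) x \<partial>M)) \<longlonglongrightarrow> cdf \<nu>' a * (\<integral>x. w' x \<partial>M')"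
      by (intro tendsto_mult massN)
    then have "(\<lambda>j. \<integral>x. w (j+N) x * indicator {..a} (Y (j+N) x) \<partial>M) \<longlonglongrightarrow> (\<integral>x. w' x * indicator {..a} (Y' x) \<partial>M')"
      unfolding law3 law'(3) using False pos by (simp add: less_imp_neq[THEN not_sym])
    then show ?thesis by (subst (asm) shift)
  qed
qed

text \<open>A continuity theorem for families of random variables that needs only the one-dimensional one.
The trigonometric factors are exchanged for indicators of half-lines one coordinate at a time:
if \<open>W\<close> is the product of the indicators obtained so far, then \<open>W * (1 + cos \<theta>)\<close> is a nonnegative
weight for every linear combination \<open>\<theta>\<close> of the variables, and its tilted characteristic functions
are again integrals of \<open>W\<close> against cosines of linear combinations, whose convergence is known by
induction. The free phase \<open>u\<close> makes a separate treatment of sines unnecessary.\<close>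
lemma orthant_probability_convergence:
  fixes Z :: "nat \<Rightarrow> 'i \<Rightarrow> 'a \<Rightarrow> real" and Z' :: "'i \<Rightarrow> 'b \<Rightarrow> real"
  assumes M: "prob_space M" and M': "prob_space M'"
    and meas[measurable]: "\<And>j i. Z j i \<in> borel_measurable M" "\<And>i. Z' i \<in> borel_measurable M'"
    and F: "finite F"
    and conv: "\<And>u c. (\<lambda>j. \<integral>x. cos (u + (\<Sum>i\<in>F. c i * Z j i x)) \<partial>M)
                  \<longlonglongrightarrow> (\<integral>x. cos (u + (\<Sum>i\<in>F. c i * Z' i x)) \<partial>M')"
    and atomless: "\<And>i a. i \<in> F \<Longrightarrow> measure M' {x\<in>space M'. Z' i x = a} = 0"
  shows "(\<lambda>j. measure M {x\<in>space M. \<forall>i\<in>F. Z j i x \<le> a i})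
           \<longlonglongrightarrow> measure M' {x\<in>space M'. \<forall>i\<in>F. Z' i x \<le> a i}"
proof -
  interpret M: prob_space M by fact
  interpret M': prob_space M' by fact
  define W where "W = (\<lambda>G j x. \<Prod>i\<in>G. indicat_real {..a i} (Z j i x))"
  define W' where "W' = (\<lambda>G x. \<Prod>i\<in>G. indicat_real {..a i} (Z' i x))"
  have W_meas[measurable]: "W G j \<in> borel_measurable M" "W' G \<in> borel_measurable M'" for G j
    unfolding W_def W'_def by measurable
  have W_bds: "0 \<le> W G j x" "W G j x \<le> 1" "0 \<le> W' G y" "W' G y \<le> 1" for G j x y
    unfolding W_def W'_def by (auto intro!: prod_nonneg prod_le_1)
  have step: "(\<lambda>j. \<integral>x. W G j x * cos (u + (\<Sum>i\<in>F. c i * Z j i x)) \<partial>M)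
     \<longlonglongrightarrow> (\<integral>x. W' G x * cos (u + (\<Sum>i\<in>F. c i * Z' i x)) \<partial>M')"
    if "G \<subseteq> F" for G u c
    using finite_subset[OF that F] that
  proof (induction G arbitrary: u c rule: finite_induct)
    case empty
    then show ?case using conv by (simp add: W_def W'_def)
  next
    case (insert k G)
    then have IH: "\<And>u c. (\<lambda>j. \<integral>x. W G j x * cos (u + (\<Sum>i\<in>F. c i * Z j i x)) \<partial>M)
        \<longlonglongrightarrow> (\<integral>x. W' G x * cos (u + (\<Sum>i\<in>F. c i * Z' i x)) \<partial>M')" and k: "k \<in> F"
      by auto
    define \<theta> where "\<theta> = (\<lambda>j x. u + (\<Sum>i\<in>F. c i * Z j i x))"
    define \<theta>' where "\<theta>' = (\<lambda>x. u + (\<Sum>i\<in>F. c i * Z' i x))"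
    have \<theta>_meas[measurable]: "\<theta> j \<in> borel_measurable M" "\<theta>' \<in> borel_measurable M'" for j
      unfolding \<theta>_def \<theta>'_def by measurable
    have shifted: "(\<lambda>j. \<integral>x. W G j x * cos (v + t * Z j k x + s * \<theta> j x) \<partial>M)
        \<longlonglongrightarrow> (\<integral>x. W' G x * cos (v + t * Z' k x + s * \<theta>' x) \<partial>M')" for v t s
    proof -
      have *: "v + t * z k + s * (u + (\<Sum>i\<in>F. c i * z i))
          = (v + s * u) + (\<Sum>i\<in>F. (s * c i + (if i = k then t else 0)) * z i)" for z :: "'i \<Rightarrow> real"
      proof -
        have "(\<Sum>i\<in>F. (if i = k then t else 0) * z i) = (\<Sum>i\<in>F. if i = k then t * z k else 0)"
          by (intro sum.cong) auto
        also have "\<dots> = t * z k" using F k by simp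
        finally show ?thesis
          by (simp add: distrib_left distrib_right sum.distrib sum_distrib_left mult.assoc)
      qed
      show ?thesis
        using IH[of "v + s * u" "\<lambda>i. s * c i + (if i = k then t else 0)"]
        unfolding \<theta>_def \<theta>'_def *[of "\<lambda>i. Z _ i _"] *[of "\<lambda>i. Z' i _"] .
    qed
    have int: "integrable M f" if "f \<in> borel_measurable M" "\<And>x. \<bar>f x\<bar> \<le> 2" for f :: "'a \<Rightarrow> real"
      using that by (auto intro!: M.integrable_const_bound[where B=2])
    have int': "integrable M' f" if "f \<in> borel_measurable M'" "\<And>x. \<bar>f x\<bar> \<le> 2" for f :: "'b \<Rightarrow> real"
      using that by (auto intro!: M'.integrable_const_bound[where B=2])
    have bounds: "\<bar>w * cos b\<bar> \<le> 2" "\<bar>w * (indicator A z :: real)\<bar> \<le> 2"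
       "\<bar>w * (1 + cos b) * (indicator A z :: real)\<bar> \<le> 2" "0 \<le> w * (1 + cos b)" "w * (1 + cos b) \<le> 2"
      if "0 \<le> w" "w \<le> 1" for w b :: real and A and z :: real
    proof -
      have c: "0 \<le> 1 + cos b" using cos_ge_minus_one[of b] by linarith
      show "\<bar>w * cos b\<bar> \<le> 2" using mult_mono[of w 1 "\<bar>cos b\<bar>" 1] that by (simp add: abs_mult)
      show "\<bar>w * (indicator A z :: real)\<bar> \<le> 2" using that by (simp split: split_indicator)
      show *: "0 \<le> w * (1 + cos b)" "w * (1 + cos b) \<le> 2"
        using that c mult_mono[of w 1 "1 + cos b" 2] by (auto intro!: mult_nonneg_nonneg)
      then show "\<bar>w * (1 + cos b) * (indicator A z :: real)\<bar> \<le> 2" by (simp split: split_indicator)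
    qed
    have expand: "w * (1 + cos b) * cos a = w * cos a + (w * cos (a + b) + w * cos (a - b)) / 2" for w a b :: real
      by (simp add: cos_add cos_diff algebra_simps)
    have tilted: "(\<lambda>j. \<integral>x. W G j x * (1 + cos (\<theta> j x)) * cos (v + t * Z j k x) \<partial>M)
        \<longlonglongrightarrow> (\<integral>x. W' G x * (1 + cos (\<theta>' x)) * cos (v + t * Z' k x) \<partial>M')" for v t
    proof -
      have 1: "(\<integral>x. W G j x * (1 + cos (\<theta> j x)) * cos (v + t * Z j k x) \<partial>M) =
        (\<integral>x. W G j x * cos (v + t * Z j k x + 0 * \<theta> j x) \<partial>M) +
        ((\<integral>x. W G j x * cos (v + t * Z j k x + 1 * \<theta> j x) \<partial>M) +
         (\<integral>x. W G j x * cos (v + t * Z j k x + (-1) * \<theta> j x) \<partial>M)) / 2" for j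
        unfolding expand using bounds(1)[OF W_bds(1,2)] by (simp add: int)
      have 2: "(\<integral>x. W' G x * (1 + cos (\<theta>' x)) * cos (v + t * Z' k x) \<partial>M') =
        (\<integral>x. W' G x * cos (v + t * Z' k x + 0 * \<theta>' x) \<partial>M') +
        ((\<integral>x. W' G x * cos (v + t * Z' k x + 1 * \<theta>' x) \<partial>M') +
         (\<integral>x. W' G x * cos (v + t * Z' k x + (-1) * \<theta>' x) \<partial>M')) / 2"
        unfolding expand using bounds(1)[OF W_bds(3,4)] by (simp add: int')
      show ?thesis
        unfolding 1 2 by (intro tendsto_intros shifted) simp
    qed
    have A: "(\<lambda>j. \<integral>x. W G j x * indicator {..a k} (Z j k x) \<partial>M)
        \<longlonglongrightarrow> (\<integral>x. W' G x * indicator {..a k} (Z' k x) \<partial>M')"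
      using W_bds shifted[of _ _ 0] k
      by (intro weighted_cdf_convergence[OF M M', where B=1] atomless) (auto simp: meas)
    have B: "(\<lambda>j. \<integral>x. W G j x * (1 + cos (\<theta> j x)) * indicator {..a k} (Z j k x) \<partial>M)
        \<longlonglongrightarrow> (\<integral>x. W' G x * (1 + cos (\<theta>' x)) * indicator {..a k} (Z' k x) \<partial>M')"
      using W_bds bounds(4,5) tilted k
      by (intro weighted_cdf_convergence[OF M M', where B=2] atomless) (auto simp: meas)
    have split: "W (insert k G) j x * cos (\<theta> j x) =
        W G j x * (1 + cos (\<theta> j x)) * indicator {..a k} (Z j k x) - W G j x * indicator {..a k} (Z j k x)"
      "W' (insert k G) y * cos (\<theta>' y) =
        W' G y * (1 + cos (\<theta>' y)) * indicator {..a k} (Z' k y) - W' G y * indicator {..a k} (Z' k y)" for j x y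
      using insert.hyps by (simp_all add: W_def W'_def algebra_simps)
    have 1: "(\<integral>x. W (insert k G) j x * cos (\<theta> j x) \<partial>M) =
        (\<integral>x. W G j x * (1 + cos (\<theta> j x)) * indicator {..a k} (Z j k x) \<partial>M) -
        (\<integral>x. W G j x * indicator {..a k} (Z j k x) \<partial>M)" for j
      unfolding split using bounds(2,3)[OF W_bds(1,2)]
      by (intro Bochner_Integration.integral_diff int) auto
    have 2: "(\<integral>x. W' (insert k G) x * cos (\<theta>' x) \<partial>M') =
        (\<integral>x. W' G x * (1 + cos (\<theta>' x)) * indicator {..a k} (Z' k x) \<partial>M') -
        (\<integral>x. W' G x * indicator {..a k} (Z' k x) \<partial>M')"
      unfolding split using bounds(2,3)[OF W_bds(3,4)]
      by (intro Bochner_Integration.integral_diff int') auto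
    have "(\<lambda>j. \<integral>x. W (insert k G) j x * cos (\<theta> j x) \<partial>M)
        \<longlonglongrightarrow> (\<integral>x. W' (insert k G) x * cos (\<theta>' x) \<partial>M')"
      unfolding 1 2 by (intro tendsto_diff A B)
    then show ?case by (simp add: \<theta>_def \<theta>'_def)
  qed
  have indicators: "(\<Prod>i\<in>F. indicat_real {..a i} (z i)) = (if \<forall>i\<in>F. z i \<le> a i then 1 else 0)" for z :: "'i \<Rightarrow> real"
    using F by (auto simp: indicator_def)
  have 1: "(\<integral>x. W F j x \<partial>M) = measure M {x\<in>space M. \<forall>i\<in>F. Z j i x \<le> a i}" for j
  proof -
    have "(\<integral>x. W F j x \<partial>M) = (\<integral>x. indicator {x\<in>space M. \<forall>i\<in>F. Z j i x \<le> a i} x \<partial>M)"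
      unfolding W_def indicators by (intro Bochner_Integration.integral_cong) auto
    then show ?thesis using F by simp
  qed
  have 2: "(\<integral>x. W' F x \<partial>M') = measure M' {x\<in>space M'. \<forall>i\<in>F. Z' i x \<le> a i}"
  proof -
    have "(\<integral>x. W' F x \<partial>M') = (\<integral>x. indicator {x\<in>space M'. \<forall>i\<in>F. Z' i x \<le> a i} x \<partial>M')"
      unfolding W'_def indicators by (intro Bochner_Integration.integral_cong) auto
    then show ?thesis using F by simp
  qed
  show ?thesis
    using step[of F 0 "\<lambda>_. 0"] by (simp add: 1 2)
qed

section \<open>Convergence of couplings on measurable rectangles\<close>

text \<open>The sets \<open>B\<close> for which convergence holds form a Dynkin system. Countable disjoint unions are the
only delicate point: the \<open>i\<close>-th term is bounded by \<open>measure M (A i)\<close> for every \<open>j\<close>, since \<open>X j\<close>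
has law \<open>M\<close>, so Tannery's theorem allows the exchange of limit and sum.\<close>
lemma one_sided_convergence_from_generator:
  fixes X :: "nat \<Rightarrow> 'n \<Rightarrow> 'a" and X' :: "'l \<Rightarrow> 'a"
  assumes N: "prob_space N" and N': "prob_space N'"
    and X[measurable]: "\<And>j. X j \<in> measurable N M" and X_law: "\<And>j. distr N M (X j) = M"
    and X'[measurable]: "X' \<in> measurable N' M" and X'_law: "distr N' M X' = M"
    and P[measurable]: "\<And>j. P j \<in> sets N" and P'[measurable]: "P' \<in> sets N'"
    and E: "Int_stable E" "E \<subseteq> Pow (space M)" "sets M = sigma_sets (space M) E"
    and basic: "\<And>B. B \<in> E \<Longrightarrow> (\<lambda>j. measure N (P j \<inter> (X j -` B \<inter> space N)))
                  \<longlonglongrightarrow> measure N' (P' \<inter> (X' -` B \<inter> space N'))"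
    and total: "(\<lambda>j. measure N (P j)) \<longlonglongrightarrow> measure N' P'"
    and B: "B \<in> sets M"
  shows "(\<lambda>j. measure N (P j \<inter> (X j -` B \<inter> space N))) \<longlonglongrightarrow> measure N' (P' \<inter> (X' -` B \<inter> space N'))"
proof -
  interpret N: prob_space N by fact
  interpret N': prob_space N' by fact
  define \<kappa> where "\<kappa> = (\<lambda>j B. measure N (P j \<inter> (X j -` B \<inter> space N)))"
  define \<kappa>' where "\<kappa>' = (\<lambda>B. measure N' (P' \<inter> (X' -` B \<inter> space N')))"
  have [measurable]: "X j -` B \<inter> space N \<in> sets N" "X' -` B \<inter> space N' \<in> sets N'" if "B \<in> sets M" for j B
    using that by (auto intro: measurable_sets)
  have additive: "(\<lambda>i. \<kappa> j (A i)) sums \<kappa> j (\<Union>i. A i)" "(\<lambda>i. \<kappa>' (A i)) sums \<kappa>' (\<Union>i. A i)"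
    if A: "range A \<subseteq> sets M" "disjoint_family A" for A j
  proof -
    have "(\<lambda>i. measure N (P j \<inter> (X j -` A i \<inter> space N))) sums measure N (\<Union>i. P j \<inter> (X j -` A i \<inter> space N))"
      using A by (intro N.finite_measure_UNION) (auto simp: disjoint_family_on_def)
    also have "(\<Union>i. P j \<inter> (X j -` A i \<inter> space N)) = P j \<inter> (X j -` (\<Union>i. A i) \<inter> space N)"
      by auto
    finally show "(\<lambda>i. \<kappa> j (A i)) sums \<kappa> j (\<Union>i. A i)" by (simp add: \<kappa>_def)
    have "(\<lambda>i. measure N' (P' \<inter> (X' -` A i \<inter> space N'))) sums measure N' (\<Union>i. P' \<inter> (X' -` A i \<inter> space N'))"
      using A by (intro N'.finite_measure_UNION) (auto simp: disjoint_family_on_def)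
    also have "(\<Union>i. P' \<inter> (X' -` A i \<inter> space N')) = P' \<inter> (X' -` (\<Union>i. A i) \<inter> space N')"
      by auto
    finally show "(\<lambda>i. \<kappa>' (A i)) sums \<kappa>' (\<Union>i. A i)" by (simp add: \<kappa>'_def)
  qed
  have dominated: "\<kappa> j A \<le> measure M A" if "A \<in> sets M" for j A
  proof -
    have "\<kappa> j A \<le> measure N (X j -` A \<inter> space N)"
      unfolding \<kappa>_def using that by (intro N.finite_measure_mono) auto
    also have "\<dots> = measure (distr N M (X j)) A"
      using that by (simp add: measure_distr)
    finally show ?thesis by (simp add: X_law)
  qed
  have M: "prob_space M"
    using N.prob_space_distr[OF X] X_law by simp
  interpret M: prob_space M by fact
  have "(\<lambda>j. \<kappa> j B) \<longlonglongrightarrow> \<kappa>' B"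
    using E(1,2) B[unfolded E(3)]
  proof (induction rule: sigma_sets_induct_disjoint)
    case (basic A)
    then show ?case using assms(12) by (simp add: \<kappa>_def \<kappa>'_def)
  next
    case empty
    then show ?case by (simp add: \<kappa>_def \<kappa>'_def)
  next
    case (compl A)
    then have A[measurable]: "A \<in> sets M" by (simp add: E)
    have "\<kappa> j (space M - A) = measure N (P j) - \<kappa> j A" for j
    proof -
      have "\<kappa> j (space M - A) = measure N (P j - (P j \<inter> (X j -` A \<inter> space N)))"
        unfolding \<kappa>_def using measurable_space[OF X] sets.sets_into_space[OF P]
        by (intro arg_cong[where f="measure N"]) blast
      also have "\<dots> = measure N (P j) - \<kappa> j A"
        unfolding \<kappa>_def by (intro N.finite_measure_Diff) auto
      finally show ?thesis .
    qed
    moreover have "\<kappa>' (space M - A) = measure N' P' - \<kappa>' A"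
    proof -
      have "\<kappa>' (space M - A) = measure N' (P' - (P' \<inter> (X' -` A \<inter> space N')))"
        unfolding \<kappa>'_def using measurable_space[OF X'] sets.sets_into_space[OF P']
        by (intro arg_cong[where f="measure N'"]) blast
      also have "\<dots> = measure N' P' - \<kappa>' A"
        unfolding \<kappa>'_def by (intro N'.finite_measure_Diff) auto
      finally show ?thesis .
    qed
    ultimately show ?case
      using compl total by (simp add: tendsto_diff)
  next
    case (union A)
    then have A: "range A \<subseteq> sets M" by (simp add: E)
    have "(\<lambda>i. measure M (A i)) sums measure M (\<Union>i. A i)"
      using A union by (intro M.finite_measure_UNION)
    moreover have "\<forall>\<^sub>F (i, j) in at_top \<times>\<^sub>F sequentially. norm (\<kappa> j (A i)) \<le> measure M (A i)"
      using dominated A by (intro always_eventually) (auto simp: \<kappa>_def)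
    ultimately have "(\<lambda>j. suminf (\<lambda>i. \<kappa> j (A i))) \<longlonglongrightarrow> suminf (\<lambda>i. \<kappa>' (A i))"
      using union(3) by (intro tannerys_theorem[THEN conjunct2, THEN conjunct2]) (auto simp: sums_iff)
    then show ?case
      using additive[OF A union(1), THEN sums_unique] by simp
  qed
  then show ?thesis by (simp add: \<kappa>_def \<kappa>'_def)
qed

text \<open>If the joint laws of two variables with fixed marginals converge on a generator, they
converge on all measurable rectangles. The limit may be any coupling, which covers both
mixing (the product coupling) and rigidity (the diagonal coupling).\<close>
lemma joint_convergence_from_generator:
  fixes X Y :: "nat \<Rightarrow> 'n \<Rightarrow> 'a" and X' Y' :: "'l \<Rightarrow> 'a"
  assumes N: "prob_space N" and N': "prob_space N'"
    and X: "\<And>j. X j \<in> measurable N M" "\<And>j. distr N M (X j) = M"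
    and Y: "\<And>j. Y j \<in> measurable N M" "\<And>j. distr N M (Y j) = M"
    and X': "X' \<in> measurable N' M" "distr N' M X' = M"
    and Y': "Y' \<in> measurable N' M" "distr N' M Y' = M"
    and E: "Int_stable E" "E \<subseteq> Pow (space M)" "sets M = sigma_sets (space M) E"
    and basic: "\<And>A B. A \<in> E \<Longrightarrow> B \<in> E \<Longrightarrow> (\<lambda>j. measure N ((X j -` A \<inter> space N) \<inter> (Y j -` B \<inter> space N)))
                  \<longlonglongrightarrow> measure N' ((X' -` A \<inter> space N') \<inter> (Y' -` B \<inter> space N'))"
    and AB: "A \<in> sets M" "B \<in> sets M"
  shows "(\<lambda>j. measure N ((X j -` A \<inter> space N) \<inter> (Y j -` B \<inter> space N)))
           \<longlonglongrightarrow> measure N' ((X' -` A \<inter> space N') \<inter> (Y' -` B \<inter> space N'))"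
proof -
  have law: "measure N (X j -` A \<inter> space N) = measure M A" "measure N' (X' -` A \<inter> space N') = measure M A"
    "measure N (Y j -` A \<inter> space N) = measure M A" "measure N' (Y' -` A \<inter> space N') = measure M A"
    if "A \<in> sets M" for A j
    using that X Y X' Y' by (metis measure_distr)+
  have *: "(\<lambda>j. measure N ((X j -` A \<inter> space N) \<inter> (Y j -` B \<inter> space N)))
           \<longlonglongrightarrow> measure N' ((X' -` A \<inter> space N') \<inter> (Y' -` B \<inter> space N'))" if A: "A \<in> E" for A
  proof (rule one_sided_convergence_from_generator[OF N N' Y Y' _ _ E])
    have "A \<in> sets M" using A E(3) by auto
    then show "X j -` A \<inter> space N \<in> sets N" "X' -` A \<inter> space N' \<in> sets N'"
      "(\<lambda>j. measure N (X j -` A \<inter> space N)) \<longlonglongrightarrow> measure N' (X' -` A \<inter> space N')" for j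
      using X X' by (auto simp: law)
  qed (use basic A AB in auto)
  have "(\<lambda>j. measure N ((Y j -` B \<inter> space N) \<inter> (X j -` A \<inter> space N)))
           \<longlonglongrightarrow> measure N' ((Y' -` B \<inter> space N') \<inter> (X' -` A \<inter> space N'))"
  proof (rule one_sided_convergence_from_generator[OF N N' X X' _ _ E])
    show "Y j -` B \<inter> space N \<in> sets N" "Y' -` B \<inter> space N' \<in> sets N'"
      "(\<lambda>j. measure N (Y j -` B \<inter> space N)) \<longlonglongrightarrow> measure N' (Y' -` B \<inter> space N')" for j
      using Y Y' AB by (auto simp: law)
  qed (use * AB in \<open>auto simp: Int_commute\<close>)
  then show ?thesis by (simp add: Int_commute)
qed

lemma (in prob_space) distr_pair_snd:
  assumes N: "sigma_finite_measure N"
  shows "distr (M \<Otimes>\<^sub>M N) N snd = N"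
proof (rule measure_eqI)
  interpret N: sigma_finite_measure N by fact
  fix A assume "A \<in> sets (distr (M \<Otimes>\<^sub>M N) N snd)"
  then have A: "A \<in> sets N" by simp
  have "snd -` A \<inter> space (M \<Otimes>\<^sub>M N) = space M \<times> A"
    using sets.sets_into_space[OF A] by (auto simp: space_pair_measure)
  with A show "emeasure (distr (M \<Otimes>\<^sub>M N) N snd) A = emeasure N A"
    by (simp add: emeasure_distr N.emeasure_pair_measure_Times emeasure_space_1)
qed simp

lemma (in prob_space) measure_pair_Times:
  assumes "A \<in> sets N" "B \<in> sets M"
  shows "measure (N \<Otimes>\<^sub>M M) (A \<times> B) = measure N A * measure M B"
  using assms by (simp add: measure_def emeasure_pair_measure_Times enn2real_mult)

lemma (in prob_space) mixing_from_generator: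
  fixes S :: "nat \<Rightarrow> 'a \<Rightarrow> 'a"
  assumes S: "\<And>j. S j \<in> measurable M M" "\<And>j. distr M M (S j) = M"
    and E: "Int_stable E" "E \<subseteq> Pow (space M)" "sets M = sigma_sets (space M) E"
    and basic: "\<And>A B. A \<in> E \<Longrightarrow> B \<in> E \<Longrightarrow>
        (\<lambda>j. measure M (A \<inter> (S j -` B \<inter> space M))) \<longlonglongrightarrow> measure M A * measure M B"
    and AB: "A \<in> sets M" "B \<in> sets M"
  shows "(\<lambda>j. measure M (A \<inter> (S j -` B \<inter> space M))) \<longlonglongrightarrow> measure M A * measure M B"
proof -
  interpret P: pair_prob_space M M ..
  have rect: "measure (M \<Otimes>\<^sub>M M) ((fst -` A \<inter> space (M \<Otimes>\<^sub>M M)) \<inter> (snd -` B \<inter> space (M \<Otimes>\<^sub>M M)))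
      = measure M A * measure M B" if "A \<in> sets M" "B \<in> sets M" for A B
  proof -
    have "(fst -` A \<inter> space (M \<Otimes>\<^sub>M M)) \<inter> (snd -` B \<inter> space (M \<Otimes>\<^sub>M M)) = A \<times> B"
      using that[THEN sets.sets_into_space] by (auto simp: space_pair_measure)
    then show ?thesis using that by (simp add: measure_pair_Times)
  qed
  have id: "((\<lambda>x. x) -` A \<inter> space M) = A" if "A \<in> sets M" for A
    using sets.sets_into_space[OF that] by auto
  have E_sets: "A \<in> sets M" if "A \<in> E" for A
    using that E(3) by auto
  have "(\<lambda>j. measure M (((\<lambda>x. x) -` A \<inter> space M) \<inter> (S j -` B \<inter> space M)))
      \<longlonglongrightarrow> measure (M \<Otimes>\<^sub>M M) ((fst -` A \<inter> space (M \<Otimes>\<^sub>M M)) \<inter> (snd -` B \<inter> space (M \<Otimes>\<^sub>M M)))"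
    by (rule joint_convergence_from_generator[OF prob_space_axioms P.prob_space_axioms _ _ S _ _ _ _ E])
       (use basic AB rect id E_sets in \<open>auto simp: distr_id2 distr_pair_fst distr_pair_snd sigma_finite_measure_axioms\<close>)
  then show ?thesis using AB by (simp add: rect id)
qed

section \<open>Gaussian laws with prescribed covariance\<close>

text \<open>The covariance matrices of families of real random variables are exactly these kernels.\<close>
definition psd_kernel :: "('i \<Rightarrow> 'i \<Rightarrow> real) \<Rightarrow> bool" where
  "psd_kernel K \<longleftrightarrow> (\<forall>m n. K m n = K n m) \<and>
     (\<forall>F c. finite F \<longrightarrow> 0 \<le> (\<Sum>m\<in>F. \<Sum>n\<in>F. c m * c n * K m n))"

lemma psd_kernelD:
  assumes "psd_kernel K"
  shows "K m n = K n m" "finite F \<Longrightarrow> 0 \<le> (\<Sum>m\<in>F. \<Sum>n\<in>F. c m * c n * K m n)"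
  using assms by (auto simp: psd_kernel_def)

text \<open>The quadratic form at \<open>c + t \<delta>\<^sub>j\<close> is a nonnegative quadratic polynomial in \<open>t\<close>, so its
discriminant is not positive.\<close>
lemma psd_kernel_Cauchy_Schwarz:
  assumes K: "psd_kernel K" and F: "finite F"
  shows "(\<Sum>m\<in>F. c m * K m j)\<^sup>2 \<le> K j j * (\<Sum>m\<in>F. \<Sum>n\<in>F. c m * c n * K m n)"
proof -
  note sym = psd_kernelD(1)[OF K]
  \<comment> \<open>The index \<open>j\<close> need not lie in \<open>F\<close>, so the coefficients are extended by zero.\<close>
  define d where "d = (\<lambda>m. if m \<in> F then c m else 0)"
  define G where "G = insert j F"
  have G: "finite G" "j \<in> G" "F \<subseteq> G" using F by (auto simp: G_def)
  define L where "L = (\<Sum>m\<in>G. d m * K m j)"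
  define Q where "Q = (\<Sum>m\<in>G. \<Sum>n\<in>G. d m * d n * K m n)"
  have L: "L = (\<Sum>m\<in>F. c m * K m j)"
    unfolding L_def using G by (intro sum.mono_neutral_cong_right) (auto simp: d_def)
  have Q: "Q = (\<Sum>m\<in>F. \<Sum>n\<in>F. c m * c n * K m n)"
    unfolding Q_def using G
    by (intro sum.mono_neutral_cong_right) (auto simp: d_def intro!: sum.mono_neutral_cong_right sum.neutral)
  have quadratic: "0 \<le> Q + 2 * t * L + t\<^sup>2 * K j j" for t
  proof -
    let ?\<delta> = "\<lambda>m. if m = j then t else 0"
    have delta: "(\<Sum>n\<in>G. ?\<delta> n * f n) = t * f j" for f :: "_ \<Rightarrow> real"
    proof -
      have "(\<Sum>n\<in>G. ?\<delta> n * f n) = (\<Sum>n\<in>G. if n = j then t * f j else 0)"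
        by (intro sum.cong) auto
      then show ?thesis using G by simp
    qed
    have "0 \<le> (\<Sum>m\<in>G. \<Sum>n\<in>G. (d m + ?\<delta> m) * (d n + ?\<delta> n) * K m n)"
      by (rule psd_kernelD(2)[OF K G(1)])
    also have "\<dots> = (\<Sum>m\<in>G. (d m + ?\<delta> m) * ((\<Sum>n\<in>G. d n * K m n) + (\<Sum>n\<in>G. ?\<delta> n * K m n)))"
      by (simp only: distrib_right distrib_left sum.distrib sum_distrib_left mult.assoc)
    also have "\<dots> = (\<Sum>m\<in>G. (d m + ?\<delta> m) * ((\<Sum>n\<in>G. d n * K m n) + t * K m j))"
      unfolding delta ..
    also have "\<dots> = (\<Sum>m\<in>G. d m * ((\<Sum>n\<in>G. d n * K m n) + t * K m j)) +
        (\<Sum>m\<in>G. ?\<delta> m * ((\<Sum>n\<in>G. d n * K m n) + t * K m j))"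
      by (simp only: distrib_right sum.distrib)
    also have "\<dots> = Q + t * L + t * ((\<Sum>n\<in>G. d n * K j n) + t * K j j)"
      unfolding delta by (simp add: Q_def L_def distrib_left sum.distrib sum_distrib_left mult_ac)
    also have "(\<Sum>n\<in>G. d n * K j n) = L"
      unfolding L_def by (simp add: sym[of j])
    finally show ?thesis by (simp add: power2_eq_square algebra_simps)
  qed
  have "0 \<le> K j j" using psd_kernelD(2)[OF K, of "{j}" "\<lambda>_. 1"] by simp
  moreover have "L = 0" if "K j j = 0"
  proof (rule ccontr)
    assume "L \<noteq> 0"
    then have "Q + 2 * (- (Q + 1) / (2 * L)) * L = -1" by (simp add: field_simps)
    with quadratic[of "- (Q + 1) / (2 * L)"] that show False by simp
  qed
  moreover have "L\<^sup>2 \<le> K j j * Q" if "K j j > 0"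
    using quadratic[of "- L / K j j"] that by (simp add: field_simps power2_eq_square)
  ultimately show ?thesis unfolding L[symmetric] Q[symmetric] by fastforce
qed

text \<open>The kernel that remains after \<open>j\<close> steps of Cholesky elimination, that is, the iterated Schur
complement. A vanishing pivot divides by zero and leaves the kernel unchanged; this is the right
value, because by Cauchy-Schwarz the whole row of a vanishing pivot is zero.\<close>
fun schur :: "(nat \<Rightarrow> nat \<Rightarrow> real) \<Rightarrow> nat \<Rightarrow> nat \<Rightarrow> nat \<Rightarrow> real" where
  "schur K 0 m n = K m n"
| "schur K (Suc j) m n = schur K j m n - schur K j m j * schur K j n j / schur K j j j"

lemma psd_kernel_schur:
  assumes "psd_kernel K"
  shows "psd_kernel (schur K j)"
proof (induction j)
  case (Suc j)
  let ?S = "schur K j"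
  have "0 \<le> (\<Sum>m\<in>F. \<Sum>n\<in>F. c m * c n * schur K (Suc j) m n)" if F: "finite F" for F c
  proof -
    let ?L = "\<Sum>m\<in>F. c m * ?S m j" and ?Q = "\<Sum>m\<in>F. \<Sum>n\<in>F. c m * c n * ?S m n"
    have "(\<Sum>m\<in>F. \<Sum>n\<in>F. c m * c n * schur K (Suc j) m n) =
       ?Q - (\<Sum>m\<in>F. \<Sum>n\<in>F. (c m * ?S m j) * (c n * ?S n j)) / ?S j j"
      by (simp add: sum_subtractf algebra_simps sum_divide_distrib)
    also have "(\<Sum>m\<in>F. \<Sum>n\<in>F. (c m * ?S m j) * (c n * ?S n j)) = ?L\<^sup>2"
      by (simp add: power2_eq_square sum_product)
    finally have eq: "(\<Sum>m\<in>F. \<Sum>n\<in>F. c m * c n * schur K (Suc j) m n) = ?Q - ?L\<^sup>2 / ?S j j" .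
    have "0 \<le> ?S j j" using psd_kernelD(2)[OF Suc, of "{j}" "\<lambda>_. 1"] by simp
    moreover have "0 \<le> ?Q" by (rule psd_kernelD(2)[OF Suc F])
    ultimately have "?L\<^sup>2 / ?S j j \<le> ?Q"
      using psd_kernel_Cauchy_Schwarz[OF Suc F, of c j]
      by (cases "?S j j = 0") (simp_all add: pos_divide_le_eq mult.commute)
    with eq show ?thesis by linarith
  qed
  then show ?case using psd_kernelD(1)[OF Suc] by (auto simp: psd_kernel_def mult.commute)
qed (use assms in \<open>simp add: psd_kernel_def\<close>)

lemma schur_eq_0:
  assumes K: "psd_kernel K" and "m < j"
  shows "schur K j m n = 0"
  using \<open>m < j\<close>
proof (induction j arbitrary: m n)
  case (Suc j)
  let ?S = "schur K j"
  have sym: "?S n j = ?S j n" by (rule psd_kernelD(1)[OF psd_kernel_schur[OF K]])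
  have "?S j n = 0" if "?S j j = 0"
    using psd_kernel_Cauchy_Schwarz[OF psd_kernel_schur[OF K, of j], of "{n}" "\<lambda>_. 1" j] that sym by simp
  with Suc sym show ?case by (cases "m = j") auto
qed simp

text \<open>Cholesky factorization of an infinite kernel. Triangularity of \<open>a\<close> makes every vector of the
Gram representation finitely supported, so that Gaussian variables with covariance \<open>K\<close> are finite
linear combinations of independent standard ones and no series has to be summed.\<close>
theorem gram_factorization:
  fixes K :: "nat \<Rightarrow> nat \<Rightarrow> real"
  assumes K: "psd_kernel K"
  obtains a where "\<And>n j. n < j \<Longrightarrow> a n j = 0"
    and "\<And>m n J. m < J \<Longrightarrow> K m n = (\<Sum>j<J. a m j * a n j)"
proof
  let ?a = "\<lambda>n j. schur K j n j / sqrt (schur K j j j)"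
  show "?a n j = 0" if "n < j" for n j
    using schur_eq_0[OF K that] by simp
  have diag: "0 \<le> schur K j j j" for j
    using psd_kernelD(2)[OF psd_kernel_schur[OF K, of j], of "{j}" "\<lambda>_. 1"] by simp
  have decomp: "K m n = (\<Sum>j<J. ?a m j * ?a n j) + schur K J m n" for m n J
    by (induction J) (use diag in simp_all)
  show "K m n = (\<Sum>j<J. ?a m j * ?a n j)" if "m < J" for m n J
    using decomp[of m n J] schur_eq_0[OF K that, of n] by linarith
qed

text \<open>A centred Gaussian law on the space of two-sided real sequences with covariance \<open>K\<close>, specified by
its characteristic functional. A cosine with a free phase \<open>u\<close> carries the same information as the
complex exponential: \<open>u = 0\<close> gives the real and \<open>u = - pi / 2\<close> the imaginary part.\<close>
definition gaussian_law :: "(int \<Rightarrow> real) measure \<Rightarrow> (int \<Rightarrow> int \<Rightarrow> real) \<Rightarrow> bool" where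
  "gaussian_law M K \<longleftrightarrow> prob_space M \<and> sets M = sets (PiM UNIV (\<lambda>_. borel)) \<and>
     (\<forall>F c u. finite F \<longrightarrow> (\<integral>x. cos (u + (\<Sum>n\<in>F. c n * x n)) \<partial>M) =
       cos u * exp (- (\<Sum>m\<in>F. \<Sum>n\<in>F. c m * c n * K m n) / 2))"

theorem gaussian_measure_exists:
  fixes K :: "int \<Rightarrow> int \<Rightarrow> real"
  assumes K: "psd_kernel K"
  obtains M where "gaussian_law M K"
proof -
  define e where "e = int_encode"
  have "psd_kernel (\<lambda>m n. K (int_decode m) (int_decode n))"
  proof -
    have "0 \<le> (\<Sum>m\<in>F. \<Sum>n\<in>F. c m * c n * K (int_decode m) (int_decode n))" if "finite F" for F c
      using psd_kernelD(2)[OF K, of "int_decode ` F" "c \<circ> int_encode"] that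
      by (simp add: sum.reindex inj_on_def int_decode_eq)
    then show ?thesis using psd_kernelD(1)[OF K] by (auto simp: psd_kernel_def)
  qed
  then obtain a where a: "\<And>n j. n < j \<Longrightarrow> a n j = 0"
    "\<And>m n J. m < J \<Longrightarrow> K (int_decode m) (int_decode n) = (\<Sum>j<J. a m j * a n j)"
    by (rule gram_factorization) blast
  define \<Omega> where "\<Omega> = PiM UNIV (\<lambda>_::nat. std_normal_distribution)"
  define X where "X = (\<lambda>\<omega> n. \<Sum>j\<le>e n. a (e n) j * \<omega> j :: real)"
  define M where "M = distr \<Omega> (PiM UNIV (\<lambda>_. borel)) X"
  interpret N: prob_space std_normal_distribution
    using real_dist_normal_dist by (simp add: real_distribution_def)
  interpret P: product_prob_space "\<lambda>_::nat. std_normal_distribution" UNIV ..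
  interpret \<Omega>: prob_space \<Omega> unfolding \<Omega>_def by (rule prob_space_PiM) (rule N.prob_space_axioms)
  have coord[measurable]: "(\<lambda>\<omega>. \<omega> j) \<in> borel_measurable \<Omega>" for j
    unfolding \<Omega>_def by measurable
  have coord_law: "distr \<Omega> borel (\<lambda>\<omega>. \<omega> j) = std_normal_distribution" for j
  proof -
    have "distr \<Omega> std_normal_distribution (\<lambda>\<omega>. \<omega> j) = std_normal_distribution"
      unfolding \<Omega>_def by (rule P.PiM_component) simp
    moreover have "distr \<Omega> std_normal_distribution (\<lambda>\<omega>. \<omega> j) = distr \<Omega> borel (\<lambda>\<omega>. \<omega> j)"
      by (rule distr_cong) auto
    ultimately show ?thesis by simp
  qed
  have indep: "\<Omega>.indep_vars (\<lambda>_. borel) (\<lambda>j \<omega>. \<omega> j) UNIV"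
  proof (subst \<Omega>.indep_vars_iff_distr_eq_PiM)
    have "distr \<Omega> (PiM UNIV (\<lambda>_. borel)) (\<lambda>x. \<lambda>i\<in>UNIV. x i) = distr \<Omega> \<Omega> (\<lambda>x. x)"
      by (rule distr_cong) (auto simp: \<Omega>_def intro!: sets_PiM_cong)
    then show "distr \<Omega> (PiM UNIV (\<lambda>_. borel)) (\<lambda>x. \<lambda>i\<in>UNIV. x i) = (\<Pi>\<^sub>M i\<in>UNIV. distr \<Omega> borel (\<lambda>\<omega>. \<omega> i))"
      by (simp add: coord_law \<Omega>_def[symmetric] distr_id2)
  qed auto
  have X_meas[measurable]: "X \<in> measurable \<Omega> (PiM UNIV (\<lambda>_. borel))"
    unfolding X_def by (rule measurable_PiM_single') auto
  show thesis
  proof (rule that[of M], unfold gaussian_law_def, intro conjI allI impI)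
    show "prob_space M" unfolding M_def by (rule \<Omega>.prob_space_distr) simp
    show "sets M = sets (PiM UNIV (\<lambda>_. borel))" by (simp add: M_def)
    fix F :: "int set" and c u assume F: "finite F"
    define J where "J = Suc (Max (insert 0 (e ` F)))"
    have J: "e i < J" if "i \<in> F" for i
      using F that unfolding J_def by (auto simp: less_Suc_eq_le)
    define b where "b = (\<lambda>j. \<Sum>i\<in>F. c i * a (e i) j)"
    have X_eq: "X \<omega> i = (\<Sum>j<J. a (e i) j * \<omega> j)" if "i \<in> F" for i \<omega>
      unfolding X_def using J[OF that] a(1) by (intro sum.mono_neutral_left) auto
    have lin: "(\<Sum>i\<in>F. c i * X \<omega> i) = (\<Sum>j<J. b j * \<omega> j)" for \<omega>
    proof -
      have "(\<Sum>i\<in>F. c i * X \<omega> i) = (\<Sum>i\<in>F. \<Sum>j<J. c i * a (e i) j * \<omega> j)"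
        by (intro sum.cong refl) (simp add: X_eq sum_distrib_left mult.assoc)
      also have "\<dots> = (\<Sum>j<J. \<Sum>i\<in>F. c i * a (e i) j * \<omega> j)" by (rule sum.swap)
      finally show ?thesis by (simp add: b_def sum_distrib_right)
    qed
    have var: "(\<Sum>j<J. (b j)\<^sup>2) = (\<Sum>i\<in>F. \<Sum>k\<in>F. c i * c k * K i k)"
    proof -
      have "(\<Sum>j<J. (b j)\<^sup>2) = (\<Sum>j<J. \<Sum>i\<in>F. \<Sum>k\<in>F. (c i * a (e i) j) * (c k * a (e k) j))"
        by (simp add: b_def power2_eq_square sum_product)
      also have "\<dots> = (\<Sum>i\<in>F. \<Sum>j<J. \<Sum>k\<in>F. (c i * a (e i) j) * (c k * a (e k) j))"
        by (rule sum.swap)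
      also have "\<dots> = (\<Sum>i\<in>F. \<Sum>k\<in>F. \<Sum>j<J. (c i * a (e i) j) * (c k * a (e k) j))"
        by (intro sum.cong refl sum.swap)
      also have "\<dots> = (\<Sum>i\<in>F. \<Sum>k\<in>F. c i * c k * K i k)"
      proof (intro sum.cong refl)
        fix i k assume "i \<in> F"
        from a(2)[OF J[OF this], of "e k"]
        show "(\<Sum>j<J. (c i * a (e i) j) * (c k * a (e k) j)) = c i * c k * K i k"
          by (simp add: e_def sum_distrib_left mult_ac)
      qed
      finally show ?thesis .
    qed
    have char1: "char (distr \<Omega> borel (\<lambda>\<omega>. b j * \<omega> j)) 1 = exp (- (b j)\<^sup>2 / 2)" for j
    proof -
      have "char (distr \<Omega> borel (\<lambda>\<omega>. b j * \<omega> j)) 1 = char (distr \<Omega> borel (\<lambda>\<omega>. \<omega> j)) (b j)"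
        unfolding char_def by (simp add: integral_distr)
      then show ?thesis by (simp add: coord_law char_std_normal_distribution)
    qed
    have "\<Omega>.indep_vars (\<lambda>_. borel) (\<lambda>j \<omega>. b j * \<omega> j) {..<J}"
      using \<Omega>.indep_vars_compose2[OF \<Omega>.indep_vars_subset[OF indep, of "{..<J}"], of "\<lambda>j x. b j * x" "\<lambda>_. borel"] by simp
    from \<Omega>.char_distr_sum[OF this, of 1]
    have "char (distr \<Omega> borel (\<lambda>\<omega>. \<Sum>j<J. b j * \<omega> j)) 1 = (\<Prod>j<J. complex_of_real (exp (- (b j)\<^sup>2 / 2)))"
      by (simp only: char1)
    also have "\<dots> = complex_of_real (exp (- (\<Sum>j<J. (b j)\<^sup>2) / 2))"
    proof -
      have "- (\<Sum>j<J. (b j)\<^sup>2) / 2 = (\<Sum>j<J. - (b j)\<^sup>2 / 2)"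
        by (simp add: sum_divide_distrib sum_negf)
      then show ?thesis
        by (simp only: of_real_prod[symmetric] exp_sum[OF finite_lessThan, symmetric])
    qed
    finally have char: "(CLINT \<omega>|\<Omega>. iexp (\<Sum>j<J. b j * \<omega> j)) = complex_of_real (exp (- (\<Sum>j<J. (b j)\<^sup>2) / 2))"
      by (simp add: char_def integral_distr)
    have int: "integrable \<Omega> (\<lambda>\<omega>. iexp (u + (\<Sum>j<J. b j * \<omega> j)))"
      by (rule \<Omega>.integrable_iexp) auto
    have "(\<integral>x. cos (u + (\<Sum>i\<in>F. c i * x i)) \<partial>M) = (\<integral>\<omega>. cos (u + (\<Sum>i\<in>F. c i * X \<omega> i)) \<partial>\<Omega>)"
      unfolding M_def by (rule integral_distr) auto
    also have "\<dots> = (\<integral>\<omega>. Re (iexp (u + (\<Sum>j<J. b j * \<omega> j))) \<partial>\<Omega>)"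
      unfolding lin by (simp only: Re_exp) simp
    also have "\<dots> = Re (CLINT \<omega>|\<Omega>. iexp (u + (\<Sum>j<J. b j * \<omega> j)))"
      using int by (rule integral_Re)
    also have "(CLINT \<omega>|\<Omega>. iexp (u + (\<Sum>j<J. b j * \<omega> j))) = iexp u * (CLINT \<omega>|\<Omega>. iexp (\<Sum>j<J. b j * \<omega> j))"
      by (simp only: of_real_add distrib_left exp_add integral_mult_right_zero)
    also have "Re \<dots> = cos u * exp (- (\<Sum>j<J. (b j)\<^sup>2) / 2)"
      unfolding char by (simp add: Re_exp)
    finally show "(\<integral>x. cos (u + (\<Sum>i\<in>F. c i * x i)) \<partial>M) =
       cos u * exp (- (\<Sum>i\<in>F. \<Sum>k\<in>F. c i * c k * K i k) / 2)"
      by (simp only: var)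
  qed
qed
text \<open>The map \<open>g\<close> may repeat coordinates. This matters below, where a sequence is considered together
with a shifted copy of itself.\<close>
lemma gaussian_law_family:
  fixes F :: "'i set" and g :: "'i \<Rightarrow> int"
  assumes M: "gaussian_law M K" and F: "finite F"
  shows "(\<integral>x. cos (u + (\<Sum>i\<in>F. c i * x (g i))) \<partial>M) =
       cos u * exp (- (\<Sum>i\<in>F. \<Sum>k\<in>F. c i * c k * K (g i) (g k)) / 2)"
proof -
  define d where "d = (\<lambda>n. \<Sum>i\<in>{i\<in>F. g i = n}. c i)"
  have collect: "(\<Sum>i\<in>F. c i * f (g i)) = (\<Sum>n\<in>g ` F. d n * f n)" for f :: "int \<Rightarrow> real"
  proof -
    have "(\<Sum>i\<in>F. c i * f (g i)) = (\<Sum>n\<in>g ` F. \<Sum>i\<in>{i\<in>F. g i = n}. c i * f (g i))"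
      by (rule sum.image_gen[OF F])
    also have "\<dots> = (\<Sum>n\<in>g ` F. d n * f n)"
      unfolding d_def sum_distrib_right by (intro sum.cong refl) auto
    finally show ?thesis .
  qed
  have "(\<Sum>i\<in>F. \<Sum>k\<in>F. c i * c k * K (g i) (g k)) = (\<Sum>i\<in>F. c i * (\<Sum>k\<in>F. c k * K (g i) (g k)))"
    by (simp add: sum_distrib_left mult.assoc)
  also have "\<dots> = (\<Sum>m\<in>g ` F. d m * (\<Sum>n\<in>g ` F. d n * K m n))"
    unfolding collect collect[of "\<lambda>m. \<Sum>n\<in>g ` F. d n * K m n"] ..
  finally have "(\<Sum>i\<in>F. \<Sum>k\<in>F. c i * c k * K (g i) (g k)) =
      (\<Sum>m\<in>g ` F. \<Sum>n\<in>g ` F. d m * d n * K m n)"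
    by (simp add: sum_distrib_left mult.assoc)
  then show ?thesis
    using M F unfolding gaussian_law_def collect by auto
qed

section \<open>Shifts of stationary Gaussian processes\<close>

definition shift :: "int \<Rightarrow> (int \<Rightarrow> real) \<Rightarrow> int \<Rightarrow> real" where
  "shift k x = (\<lambda>n. x (n + k))"

definition orthants :: "(int \<Rightarrow> real) set set" where
  "orthants = {{x. \<forall>n\<in>F. x n \<le> a n} | F a. finite F}"

text \<open>Orthants restrict finitely many coordinates; in an intersection, coordinates
restricted twice get the smaller bound.\<close>
lemma Int_stable_orthants: "Int_stable orthants"
proof (rule Int_stableI)
  fix A B assume "A \<in> orthants" "B \<in> orthants"
  then obtain F a G b where F: "finite F" "A = {x. \<forall>n\<in>F. x n \<le> a n}"
    and G: "finite G" "B = {x. \<forall>n\<in>G. x n \<le> b n}"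
    unfolding orthants_def by blast
  define c where "c = (\<lambda>n. if n \<in> F then if n \<in> G then min (a n) (b n) else a n else b n)"
  have "A \<inter> B = {x. \<forall>n\<in>F \<union> G. x n \<le> c n}"
    unfolding F G by (auto simp: c_def)
  then show "A \<inter> B \<in> orthants"
    using F(1) G(1) unfolding orthants_def by blast
qed

lemma sets_PiM_eq_sigma_orthants:
  "sets (PiM UNIV (\<lambda>_::int. borel :: real measure)) = sigma_sets UNIV orthants"
proof
  have "{x. \<forall>n\<in>F. x n \<le> a n} \<in> sets (PiM UNIV (\<lambda>_::int. borel :: real measure))" if "finite F" for F a
  proof -
    have "{x \<in> space (PiM UNIV (\<lambda>_::int. borel :: real measure)). \<forall>n\<in>F. x n \<le> a n} \<in> sets (PiM UNIV (\<lambda>_. borel))"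
      using that by measurable
    then show ?thesis by (simp add: space_PiM)
  qed
  then have "orthants \<subseteq> sets (PiM UNIV (\<lambda>_::int. borel :: real measure))"
    unfolding orthants_def by blast
  then show "sigma_sets UNIV orthants \<subseteq> sets (PiM UNIV (\<lambda>_::int. borel :: real measure))"
    using sets.sigma_sets_subset[of orthants "PiM UNIV (\<lambda>_::int. borel :: real measure)"] by (simp add: space_PiM)
next
  let ?S = "sigma UNIV orthants"
  have sets_S: "sets ?S = sigma_sets UNIV orthants" "space ?S = UNIV" by (auto simp: sets_measure_of space_measure_of_conv)
  have "(\<lambda>x. x) \<in> measurable ?S (PiM UNIV (\<lambda>_::int. borel :: real measure))"
  proof (rule measurable_PiM_single')
    fix n :: int
    have "{x. x n \<le> a} \<in> orthants" for a :: real
      unfolding orthants_def by (auto intro!: exI[of _ "{n}"])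
    then show "(\<lambda>x. x n) \<in> borel_measurable ?S"
      unfolding borel_measurable_iff_le by (auto simp: sets_S)
  qed auto
  then have "(\<lambda>x. x) -` A \<inter> space ?S \<in> sets ?S" if "A \<in> sets (PiM UNIV (\<lambda>_::int. borel :: real measure))" for A
    using that by (rule measurable_sets)
  then show "sets (PiM UNIV (\<lambda>_::int. borel :: real measure)) \<subseteq> sigma_sets UNIV orthants"
    by (auto simp: sets_S)
qed

lemma std_normal_le_lborel:
  assumes "A \<in> sets borel"
  shows "emeasure std_normal_distribution A \<le> emeasure lborel A"
proof -
  have "1 / sqrt (2 * pi) \<le> 1" using pi_ge_two by simp
  then have "std_normal_density x \<le> 1" for x
    using mult_mono[of "1 / sqrt (2 * pi)" 1 "exp (- x\<^sup>2 / 2)" 1] by (simp add: std_normal_density_def)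
  then have "(\<integral>\<^sup>+x. ennreal (std_normal_density x) * indicator A x \<partial>lborel) \<le> (\<integral>\<^sup>+x. indicator A x \<partial>lborel)"
    by (intro nn_integral_mono) (auto split: split_indicator)
  then show ?thesis using assms by (simp add: emeasure_density)
qed

text \<open>A stationary Gaussian process of unit variance. Its covariance depends on the difference of the
indices only, so it is given by one even function \<open>r\<close>.\<close>
locale gaussian_shift =
  fixes M :: "(int \<Rightarrow> real) measure" and r :: "int \<Rightarrow> real"
  assumes law: "gaussian_law M (\<lambda>m n. r (m - n))"
    and even: "r (- n) = r n" and unit_variance: "r 0 = 1"
begin

sublocale prob_space M
  using law by (simp add: gaussian_law_def)

lemma sets_M: "sets M = sets (PiM UNIV (\<lambda>_. borel))"
  using law by (simp add: gaussian_law_def)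

lemma space_M[simp]: "space M = UNIV"
  using sets_eq_imp_space_eq[OF sets_M] by (simp add: space_PiM)

lemma coord[measurable]: "(\<lambda>x. x n) \<in> borel_measurable M"
proof -
  have "(\<lambda>x. x n) \<in> borel_measurable (PiM UNIV (\<lambda>_. borel))" by measurable
  then show ?thesis by (simp cong: measurable_cong_sets add: sets_M)
qed

lemma shift_measurable[measurable]: "shift k \<in> measurable M M"
proof -
  have "shift k \<in> measurable M (PiM UNIV (\<lambda>_. borel))"
    unfolding shift_def by (rule measurable_PiM_single') (auto simp: coord)
  then show ?thesis using measurable_cong_sets[OF refl sets_M, of M] by simp
qed

lemma coord_law: "distr M borel (\<lambda>x. x n) = std_normal_distribution"
proof (rule Levy_uniqueness)
  have cos: "(\<integral>x. cos (u + t * x n) \<partial>M) = cos u * exp (- t\<^sup>2 / 2)" for u t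
    using gaussian_law_family[OF law, of "{()}" u "\<lambda>_. t" "\<lambda>_. n"]
    by (simp add: unit_variance power2_eq_square)
  have int: "integrable M (\<lambda>x. iexp (t * x n))" for t
    by (rule integrable_iexp) auto
  have "cos (- (pi / 2) + t) = sin t" for t :: real by (simp only: cos_add) simp
  then have sin: "(\<integral>x. sin (t * x n) \<partial>M) = 0" for t
    using cos[of "- (pi / 2)" t] by simp
  show "char (distr M borel (\<lambda>x. x n)) = char std_normal_distribution"
  proof
    fix t
    have "char (distr M borel (\<lambda>x. x n)) t = (CLINT x|M. iexp (t * x n))"
      by (simp add: char_def integral_distr)
    also have "\<dots> = exp (- t\<^sup>2 / 2)"
    proof (rule complex_eqI)
      have "Re (CLINT x|M. iexp (t * x n)) = (\<integral>x. cos (t * x n) \<partial>M)"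
        using integral_Re[OF int, of t] by (simp add: Re_exp)
      then show "Re (CLINT x|M. iexp (t * x n)) = Re (exp (- t\<^sup>2 / 2))"
        using cos[of 0 t] by simp
      have "Im (CLINT x|M. iexp (t * x n)) = (\<integral>x. sin (t * x n) \<partial>M)"
        using integral_Im[OF int, of t] by (simp add: Im_exp)
      then show "Im (CLINT x|M. iexp (t * x n)) = Im (exp (- t\<^sup>2 / 2))"
        using sin[of t] by simp
    qed
    finally show "char (distr M borel (\<lambda>x. x n)) t = char std_normal_distribution t"
      by (simp add: char_std_normal_distribution)
  qed
qed (use real_dist_normal_dist in
    \<open>auto simp: real_distribution_def real_distribution_axioms_def prob_space_distr\<close>)

text \<open>The law of a coordinate has a density bounded by one. This yields both the absence of atoms on the
line and small sets inside every set of positive measure.\<close>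
lemma coord_le_lborel:
  assumes "A \<in> sets borel"
  shows "emeasure M {x. x n \<in> A} \<le> emeasure lborel A"
proof -
  have "emeasure M {x. x n \<in> A} = emeasure (distr M borel (\<lambda>x. x n)) A"
    using assms by (simp add: emeasure_distr vimage_def)
  then show ?thesis using std_normal_le_lborel[OF assms] by (simp add: coord_law)
qed

lemma coord_no_atoms: "measure M {x\<in>space M. x n = a} = 0"
  using coord_le_lborel[of "{a}" n] by (simp add: measure_def)

text \<open>Applied to a constant sequence, the continuity theorem says that the law is determined by its
characteristic functional, which depends on differences of indices only.\<close>
lemma distr_shift: "distr M M (shift k) = M"
proof (rule measure_eqI_generator_eq[OF Int_stable_orthants, where \<Omega>=UNIV and A="\<lambda>_. UNIV"])
  fix A assume "A \<in> orthants"
  then obtain F a where F: "finite F" and A: "A = {x. \<forall>n\<in>F. x n \<le> a n}"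
    unfolding orthants_def by blast
  have "(\<lambda>j::nat. measure M {x\<in>space M. \<forall>n\<in>F. x (n + k) \<le> a n})
      \<longlonglongrightarrow> measure M {x\<in>space M. \<forall>n\<in>F. x n \<le> a n}"
  proof (rule orthant_probability_convergence[OF prob_space_axioms prob_space_axioms _ _ F])
    show "(\<lambda>j::nat. \<integral>x. cos (u + (\<Sum>n\<in>F. c n * x (n + k))) \<partial>M)
        \<longlonglongrightarrow> (\<integral>x. cos (u + (\<Sum>n\<in>F. c n * x n)) \<partial>M)" for u c
      using gaussian_law_family[OF law F, of u c "\<lambda>n. n + k"] gaussian_law_family[OF law F, of u c "\<lambda>n. n"]
      by simp
  qed (auto simp: coord_no_atoms[simplified])
  then have "measure M (shift k -` A) = measure M A"
    by (simp add: A LIMSEQ_const_iff vimage_def shift_def)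
  moreover have "A \<in> sets M"
    using \<open>A \<in> orthants\<close> sets_PiM_eq_sigma_orthants sets_M by auto
  ultimately show "emeasure (distr M M (shift k)) A = emeasure M A"
    by (simp add: emeasure_distr emeasure_eq_measure)
next
  show "range (\<lambda>_::nat. UNIV) \<subseteq> orthants"
    unfolding orthants_def by (auto intro!: exI[of _ "{}"])
  show "emeasure (distr M M (shift k)) UNIV \<noteq> \<infinity>"
    using emeasure_distr[OF shift_measurable, of UNIV k] sets.top[of M] by simp
qed (auto simp: sets_M sets_PiM_eq_sigma_orthants)

text \<open>The pair \<open>(x, shift (k j) x)\<close> is a Gaussian family indexed by \<open>int + int\<close>. If its covariances converge
to those of a Gaussian coupling \<open>(U, V)\<close>, then its joint law converges to that of the coupling on all
measurable rectangles.\<close>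
lemma shifted_pairs_converge:
  fixes U V :: "'l \<Rightarrow> int \<Rightarrow> real" and k :: "nat \<Rightarrow> int"
  defines "W \<equiv> (\<lambda>i y. case i of Inl n \<Rightarrow> U y n | Inr n \<Rightarrow> V y n)"
  assumes N: "prob_space N"
    and U: "U \<in> measurable N M" "distr N M U = M"
    and V: "V \<in> measurable N M" "distr N M V = M"
    and W: "\<And>F u c. finite F \<Longrightarrow> (\<integral>y. cos (u + (\<Sum>i\<in>F. c i * W i y)) \<partial>N) =
                cos u * exp (- (\<Sum>i\<in>F. \<Sum>i'\<in>F. c i * c i' * C i i') / 2)"
    and C: "\<And>n n'. C (Inl n) (Inl n') = r (n - n')" "\<And>n n'. C (Inr n) (Inr n') = r (n - n')"
      "\<And>n n'. (\<lambda>j. r (n - n' + k j)) \<longlonglongrightarrow> C (Inr n) (Inl n')" "\<And>i i'. C i i' = C i' i"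
    and AB: "A \<in> sets M" "B \<in> sets M"
  shows "(\<lambda>j. measure M (A \<inter> shift (k j) -` B)) \<longlonglongrightarrow> measure N (U -` A \<inter> V -` B \<inter> space N)"
proof -
  interpret N: prob_space N by fact
  define g where "g = (\<lambda>j i. case i of Inl n \<Rightarrow> n | Inr n \<Rightarrow> n + k j)"
  have g: "(\<lambda>j. r (g j i - g j i')) \<longlonglongrightarrow> C i i'" for i i'
  proof (cases i; cases i')
    fix n n' assume "i = Inl n" "i' = Inr n'"
    moreover have "r (n - (n' + k j)) = r (n' - n + k j)" for j
      using even[of "n - (n' + k j)"] by (simp add: algebra_simps)
    ultimately show ?thesis using C(3)[of n' n] by (simp add: g_def C(4)[of "Inl n" "Inr n'"])
  next
    fix n n' assume "i = Inr n" "i' = Inl n'"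
    then show ?thesis using C(3)[of n n'] by (simp add: g_def algebra_simps)
  qed (auto simp: g_def C)
  have UVm[measurable]: "(\<lambda>y. U y n) \<in> borel_measurable N" "(\<lambda>y. V y n) \<in> borel_measurable N" for n
    using measurable_compose[OF U(1) coord] measurable_compose[OF V(1) coord] by auto
  have W_meas: "W i \<in> borel_measurable N" for i
    unfolding W_def by (cases i) auto
  have level_set: "{x\<in>space M. x n = a} \<in> sets M" for n a
    by measurable
  have no_atoms: "measure N {y\<in>space N. W i y = a} = 0" for i a
  proof (cases i)
    case (Inl n)
    have "{x. x n = a} \<in> sets M" using level_set[of n a] by simp
    with U have "measure N (U -` {x. x n = a} \<inter> space N) = measure M {x. x n = a}"
      by (metis measure_distr)
    then show ?thesis using coord_no_atoms[of n a] by (simp add: Inl W_def vimage_def Int_def conj_commute)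
  next
    case (Inr n)
    have "{x. x n = a} \<in> sets M" using level_set[of n a] by simp
    with V have "measure N (V -` {x. x n = a} \<inter> space N) = measure M {x. x n = a}"
      by (metis measure_distr)
    then show ?thesis using coord_no_atoms[of n a] by (simp add: Inr W_def vimage_def Int_def conj_commute)
  qed
  have orthant_case: "(\<lambda>j. measure M (A \<inter> shift (k j) -` B)) \<longlonglongrightarrow> measure N (U -` A \<inter> V -` B \<inter> space N)"
    if "A \<in> orthants" "B \<in> orthants" for A B
  proof -
    from that obtain F a G b where F: "finite F" "A = {x. \<forall>n\<in>F. x n \<le> a n}"
      and G: "finite G" "B = {x. \<forall>n\<in>G. x n \<le> b n}"
      unfolding orthants_def by blast
    have "(\<lambda>j. measure M {x\<in>space M. \<forall>i\<in>F <+> G. x (g j i) \<le> case_sum a b i})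
       \<longlonglongrightarrow> measure N {y\<in>space N. \<forall>i\<in>F <+> G. W i y \<le> case_sum a b i}"
    proof (rule orthant_probability_convergence[OF prob_space_axioms N])
      show FG: "finite (F <+> G)" using F G by simp
      show "(\<lambda>j. \<integral>x. cos (u + (\<Sum>i\<in>F <+> G. c i * x (g j i))) \<partial>M)
          \<longlonglongrightarrow> (\<integral>y. cos (u + (\<Sum>i\<in>F <+> G. c i * W i y)) \<partial>N)" for u c
        unfolding gaussian_law_family[OF law FG] W[OF FG]
        by (intro tendsto_intros g) simp
    qed (use W_meas no_atoms in auto)
    moreover have ball_Plus: "(\<forall>i\<in>F <+> G. P i) \<longleftrightarrow> (\<forall>n\<in>F. P (Inl n)) \<and> (\<forall>n\<in>G. P (Inr n))" for P
      by auto
    have "{x\<in>space M. \<forall>i\<in>F <+> G. x (g j i) \<le> case_sum a b i} = A \<inter> shift (k j) -` B" for j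
      unfolding ball_Plus by (auto simp: F G g_def shift_def)
    moreover have "{y\<in>space N. \<forall>i\<in>F <+> G. W i y \<le> case_sum a b i} = U -` A \<inter> V -` B \<inter> space N"
      unfolding ball_Plus by (auto simp: F G W_def)
    ultimately show ?thesis by simp
  qed
  have "(\<lambda>j. measure M (((\<lambda>x. x) -` A \<inter> space M) \<inter> (shift (k j) -` B \<inter> space M)))
      \<longlonglongrightarrow> measure N ((U -` A \<inter> space N) \<inter> (V -` B \<inter> space N))"
  proof (rule joint_convergence_from_generator[OF prob_space_axioms N _ _ _ _ U V Int_stable_orthants])
    show "sets M = sigma_sets (space M) orthants" by (simp add: sets_M sets_PiM_eq_sigma_orthants)
    show "(\<lambda>j. measure M (((\<lambda>x. x) -` A \<inter> space M) \<inter> (shift (k j) -` B \<inter> space M)))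
      \<longlonglongrightarrow> measure N ((U -` A \<inter> space N) \<inter> (V -` B \<inter> space N))"
      if "A \<in> orthants" "B \<in> orthants" for A B
      using orthant_case[OF that] by (simp add: Int_assoc Int_left_commute)
  qed (use AB in \<open>auto simp: distr_shift distr_id2\<close>)
  then show ?thesis by (simp add: Int_assoc Int_left_commute)
qed

text \<open>If the covariances at the times \<open>k j\<close> vanish in the limit, then the limiting Gaussian coupling is the
independent one.\<close>
lemma mixing_along:
  assumes k: "\<And>n. (\<lambda>j. r (n + k j)) \<longlonglongrightarrow> 0"
    and AB: "A \<in> sets M" "B \<in> sets M"
  shows "(\<lambda>j. measure M (A \<inter> shift (k j) -` B)) \<longlonglongrightarrow> measure M A * measure M B"
proof -
  interpret P: pair_prob_space M M ..
  define C where "C = (\<lambda>i i'. case i of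
      Inl n \<Rightarrow> (case i' of Inl n' \<Rightarrow> r (n - n') | Inr _ \<Rightarrow> 0)
    | Inr n \<Rightarrow> (case i' of Inl _ \<Rightarrow> 0 | Inr n' \<Rightarrow> r (n - n')))"
  have "(\<lambda>j. measure M (A \<inter> shift (k j) -` B))
      \<longlonglongrightarrow> measure (M \<Otimes>\<^sub>M M) (fst -` A \<inter> snd -` B \<inter> space (M \<Otimes>\<^sub>M M))"
  proof (rule shifted_pairs_converge[where C=C, OF P.prob_space_axioms _ _ _ _ _ _ _ _ _ AB])
    show "distr (M \<Otimes>\<^sub>M M) M fst = M" by (rule distr_pair_fst)
    show "distr (M \<Otimes>\<^sub>M M) M snd = M" by (rule distr_pair_snd[OF sigma_finite_measure_axioms])
    fix F :: "(int + int) set" and u :: real and c :: "int + int \<Rightarrow> real" assume F: "finite F"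
    define F1 where "F1 = Inl -` F"
    define F2 where "F2 = Inr -` F"
    have fin: "finite F1" "finite F2" and split: "F = F1 <+> F2"
      using F finite_vimageI[of F Inl] finite_vimageI[of F Inr]
      by (auto simp: F1_def F2_def elim: sum.exhaust) (metis sum.exhaust InlI InrI vimageI)
    define Q1 where "Q1 = (\<Sum>n\<in>F1. \<Sum>n'\<in>F1. c (Inl n) * c (Inl n') * r (n - n'))"
    define Q2 where "Q2 = (\<Sum>n\<in>F2. \<Sum>n'\<in>F2. c (Inr n) * c (Inr n') * r (n - n'))"
    have Q: "(\<Sum>i\<in>F. \<Sum>i'\<in>F. c i * c i' * C i i') = Q1 + Q2"
      unfolding split sum.Plus[OF fin] Q1_def Q2_def by (simp add: C_def)
    let ?f = "\<lambda>y::(int \<Rightarrow> real) \<times> (int \<Rightarrow> real). cos ((u + (\<Sum>n\<in>F1. c (Inl n) * fst y n)) + (\<Sum>n\<in>F2. c (Inr n) * snd y n))"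
    have meas[measurable]: "(\<lambda>y. fst y n) \<in> borel_measurable (M \<Otimes>\<^sub>M M)" "(\<lambda>y. snd y n) \<in> borel_measurable (M \<Otimes>\<^sub>M M)" for n
      using measurable_compose[OF measurable_fst coord] measurable_compose[OF measurable_snd coord] by auto
    have "integrable (M \<Otimes>\<^sub>M M) ?f"
      by (rule P.integrable_const_bound[where B=1]) auto
    \<comment> \<open>By Fubini the characteristic functional of the product law factorizes.\<close>
    then have "(\<integral>y. ?f y \<partial>(M \<Otimes>\<^sub>M M)) = (\<integral>x. \<integral>y. ?f (x, y) \<partial>M \<partial>M)"
      by (rule P.integral_fst'[symmetric])
    also have "\<dots> = (\<integral>x. cos (u + (\<Sum>n\<in>F1. c (Inl n) * x n)) * exp (- Q2 / 2) \<partial>M)"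
      using law fin unfolding gaussian_law_def by (simp add: Q2_def)
    also have "\<dots> = cos u * exp (- Q1 / 2) * exp (- Q2 / 2)"
      using law fin unfolding gaussian_law_def by (simp add: Q1_def)
    also have "\<dots> = cos u * exp (- (\<Sum>i\<in>F. \<Sum>i'\<in>F. c i * c i' * C i i') / 2)"
      unfolding Q by (simp add: exp_add[symmetric] mult.assoc add_divide_distrib)
    finally show "(\<integral>y. cos (u + (\<Sum>i\<in>F. c i * (case i of Inl n \<Rightarrow> fst y n | Inr n \<Rightarrow> snd y n))) \<partial>(M \<Otimes>\<^sub>M M)) =
       cos u * exp (- (\<Sum>i\<in>F. \<Sum>i'\<in>F. c i * c i' * C i i') / 2)"
      unfolding split sum.Plus[OF fin] by (simp add: add.assoc)
  next
    show "C i i' = C i' i" for i i'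
      using even by (auto simp: C_def split: sum.splits) (metis minus_diff_eq)+
  qed (use k in \<open>auto simp: C_def\<close>)
  moreover have "fst -` A \<inter> snd -` B \<inter> space (M \<Otimes>\<^sub>M M) = A \<times> B"
    by (auto simp: space_pair_measure)
  ultimately show ?thesis using AB by (simp add: measure_pair_Times)
qed

text \<open>If the covariances at the times \<open>k j\<close> return to their initial values, then the limiting coupling is
concentrated on the diagonal.\<close>
lemma recurrence_along:
  assumes k: "\<And>n. (\<lambda>j. r (n + k j)) \<longlonglongrightarrow> r n"
    and AB: "A \<in> sets M" "B \<in> sets M"
  shows "(\<lambda>j. measure M (A \<inter> shift (k j) -` B)) \<longlonglongrightarrow> measure M (A \<inter> B)"
proof -
  define g :: "int + int \<Rightarrow> int" where "g = case_sum id id"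
  have "(\<lambda>j. measure M (A \<inter> shift (k j) -` B)) \<longlonglongrightarrow> measure M ((\<lambda>x. x) -` A \<inter> (\<lambda>x. x) -` B \<inter> space M)"
  proof (rule shifted_pairs_converge[where C="\<lambda>i i'. r (g i - g i')", OF prob_space_axioms _ _ _ _ _ _ _ _ _ AB])
    fix F :: "(int + int) set" and u :: real and c :: "int + int \<Rightarrow> real" assume F: "finite F"
    have "(case i of Inl n \<Rightarrow> y n | Inr n \<Rightarrow> y n) = y (g i)" for i and y :: "int \<Rightarrow> real"
      by (simp add: g_def split: sum.splits)
    then show "(\<integral>y. cos (u + (\<Sum>i\<in>F. c i * (case i of Inl n \<Rightarrow> y n | Inr n \<Rightarrow> y n))) \<partial>M) =
       cos u * exp (- (\<Sum>i\<in>F. \<Sum>i'\<in>F. c i * c i' * r (g i - g i')) / 2)"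
      using gaussian_law_family[OF law F] by simp
  next
    show "r (g i - g i') = r (g i' - g i)" for i i'
      using even by (metis minus_diff_eq)
  qed (use k in \<open>auto simp: g_def distr_id2\<close>)
  then show ?thesis by simp
qed

lemma shift_add: "shift j (shift k x) = shift (j + k) x"
  by (simp add: shift_def add_ac)

lemma shift_0[simp]: "shift 0 x = x"
  by (simp add: shift_def)

lemma funpow_shift: "shift k ^^ n = shift (int n * k)"
proof (induction n)
  case (Suc n)
  have "k + int n * k = int (Suc n) * k" by (simp add: algebra_simps)
  then have "shift k \<circ> shift (int n * k) = shift (int (Suc n) * k)"
    by (intro ext) (simp only: o_apply shift_add)
  then show ?case by (simp only: funpow.simps Suc)
qed (simp add: fun_eq_iff)

lemma bij_shift: "bij (shift k)"
  by (rule o_bij[where g="shift (- k)"]) (auto simp: fun_eq_iff shift_add)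

lemma inv_shift: "inv (shift k) = shift (- k)"
  by (rule inv_unique_comp) (auto simp: fun_eq_iff shift_add)

lemma int_iterate_shift: "int_iterate (shift 1) M n = shift n"
  by (simp add: int_iterate_def inv_shift funpow_shift)

text \<open>Since \<open>shift\<close> preserves the measure, the symmetric difference of \<open>A\<close> and its translate has measure
\<open>2 * measure M A - 2 * measure M (A \<inter> shift (- k j) -` A)\<close>. Images under \<open>shift (k j)\<close> are preimages under
\<open>shift (- k j)\<close>, and evenness of \<open>r\<close> makes the sequence \<open>- k\<close> as good as \<open>k\<close>.\<close>
lemma rigidity_sequence_shift:
  assumes k: "\<And>n. (\<lambda>j. r (n + k j)) \<longlonglongrightarrow> r n"
  shows "rigidity_sequence k (shift 1) M"
  unfolding rigidity_sequence_def int_iterate_shift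
proof
  fix A assume A[measurable]: "A \<in> sets M"
  have backward: "(\<lambda>j. r (n + - k j)) \<longlonglongrightarrow> r n" for n
  proof -
    have "r (n + - k j) = r (- n + k j)" for j
      using even[of "- n + k j"] by (simp add: algebra_simps)
    then show ?thesis using k[of "- n"] even[of n] by simp
  qed
  have image: "shift n ` A = shift (- n) -` A" for n
    using bij_shift by (metis bij_vimage_eq_inv_image inv_shift minus_minus)
  have meas: "shift n -` A \<in> sets M" for n
    using measurable_sets[OF shift_measurable A] by simp
  have "measure M (sym_diff (shift (k j) ` A) A) = 2 * measure M A - 2 * measure M (A \<inter> shift (- k j) -` A)" for j
  proof -
    let ?B = "shift (- k j) -` A"
    have "measure M ?B = measure M A"
      using measure_distr[OF shift_measurable A, of "- k j"] by (simp add: distr_shift)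
    moreover have "measure M (sym_diff ?B A) = measure M (?B - A) + measure M (A - ?B)"
      using meas by (intro finite_measure_Union) auto
    moreover have "measure M (?B - A) = measure M ?B - measure M (A \<inter> ?B)" "measure M (A - ?B) = measure M A - measure M (A \<inter> ?B)"
      using meas finite_measure_Diff'[of ?B A] finite_measure_Diff'[of A ?B] by (auto simp: Int_commute)
    ultimately show ?thesis by (simp add: image)
  qed
  moreover have "(\<lambda>j. 2 * measure M A - 2 * measure M (A \<inter> shift (- k j) -` A)) \<longlonglongrightarrow> 2 * measure M A - 2 * measure M (A \<inter> A)"
    by (intro tendsto_intros recurrence_along backward A)
  ultimately show "(\<lambda>j. measure M (sym_diff (shift (k j) ` A) A)) \<longlonglongrightarrow> 0" by simp
qed

text \<open>Mixing along one sequence of times passes to the product system, first for rectangles and then for all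
measurable sets. An invariant set \<open>A\<close> of the product system then satisfies \<open>\<mu> A = \<mu> A * \<mu> A\<close>.\<close>
lemma weakly_mixing_shift:
  fixes k :: "nat \<Rightarrow> nat"
  assumes k: "\<And>n. (\<lambda>j. r (n + int (k j))) \<longlonglongrightarrow> 0"
  shows "weakly_mixing (shift 1) M"
  unfolding weakly_mixing_def ergodic_def
proof (intro ballI impI)
  interpret P: pair_prob_space M M ..
  let ?S = "\<lambda>n. map_prod (shift n) (shift n)"
  have space: "space (M \<Otimes>\<^sub>M M) = UNIV" by (simp add: space_pair_measure)
  have S_meas: "?S n \<in> measurable (M \<Otimes>\<^sub>M M) (M \<Otimes>\<^sub>M M)" for n
    unfolding map_prod_def by measurable
  fix A assume A: "A \<in> sets (M \<Otimes>\<^sub>M M)" and "?S 1 -` A \<inter> space (M \<Otimes>\<^sub>M M) = A"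
  then have "?S 1 -` A = A" by (simp add: space)
  then have inv: "?S (int n) -` A = A" for n
  proof (induction n)
    case (Suc n)
    have "?S (int (Suc n)) -` A = ?S (int n) -` (?S 1 -` A)"
      by (auto simp: shift_add add.commute)
    with Suc show ?case by simp
  qed (auto simp: map_prod_def)
  let ?E = "{a \<times> b | a b. a \<in> sets M \<and> b \<in> sets M}"
  have S_law: "distr (M \<Otimes>\<^sub>M M) (M \<Otimes>\<^sub>M M) (?S n) = M \<Otimes>\<^sub>M M" for n
    using pair_measure_distr[OF shift_measurable shift_measurable, of n n] sigma_finite_measure_axioms
    by (simp add: distr_shift map_prod_def case_prod_beta')
  have basic: "(\<lambda>j. measure (M \<Otimes>\<^sub>M M) (A \<inter> ?S (int (k j)) -` B)) \<longlonglongrightarrow> measure (M \<Otimes>\<^sub>M M) A * measure (M \<Otimes>\<^sub>M M) B"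
    if "A \<in> ?E" "B \<in> ?E" for A B
  proof -
    from that obtain a b c d where A: "A = a \<times> b" "a \<in> sets M" "b \<in> sets M"
      and B: "B = c \<times> d" "c \<in> sets M" "d \<in> sets M"
      by blast
    have meas: "shift n -` C \<in> sets M" if "C \<in> sets M" for n C
      using measurable_sets[OF shift_measurable that] by simp
    have "A \<inter> ?S n -` B = (a \<inter> shift n -` c) \<times> (b \<inter> shift n -` d)" for n
      by (auto simp: A B)
    then have "measure (M \<Otimes>\<^sub>M M) (A \<inter> ?S n -` B) = measure M (a \<inter> shift n -` c) * measure M (b \<inter> shift n -` d)" for n
      using A B meas by (simp add: measure_pair_Times)
    moreover have "(\<lambda>j. measure M (a \<inter> shift (int (k j)) -` c) * measure M (b \<inter> shift (int (k j)) -` d))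
       \<longlonglongrightarrow> (measure M a * measure M c) * (measure M b * measure M d)"
      using A B k by (intro tendsto_mult mixing_along)
    ultimately show ?thesis using A B by (simp add: measure_pair_Times mult_ac)
  qed
  have "(\<lambda>j. measure (M \<Otimes>\<^sub>M M) (A \<inter> (?S (int (k j)) -` A \<inter> space (M \<Otimes>\<^sub>M M))))
      \<longlonglongrightarrow> measure (M \<Otimes>\<^sub>M M) A * measure (M \<Otimes>\<^sub>M M) A"
  proof (rule P.mixing_from_generator[OF S_meas S_law Int_stable_pair_measure_generator _ _ _ A A])
    show "sets (M \<Otimes>\<^sub>M M) = sigma_sets (space (M \<Otimes>\<^sub>M M)) ?E"
      by (simp add: sets_pair_measure space_pair_measure)
  qed (use basic in \<open>auto simp: space\<close>)
  then have "measure (M \<Otimes>\<^sub>M M) A = measure (M \<Otimes>\<^sub>M M) A * measure (M \<Otimes>\<^sub>M M) A"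
    by (simp add: inv space LIMSEQ_const_iff)
  then show "measure (M \<Otimes>\<^sub>M M) A = 0 \<or> measure (M \<Otimes>\<^sub>M M) A = 1"
    by (metis mult_cancel_left1)
qed

lemma dynamical_system_shift: "dynamical_system (shift 1) M"
  unfolding dynamical_system_def standard_prob_space_def
proof (intro conjI exI[of _ euclidean])
  show "completely_metrizable_space (euclidean :: (int \<Rightarrow> real) topology)"
    unfolding euclidean_product_topology[symmetric]
    by (simp add: completely_metrizable_space_product_topology completely_metrizable_space_euclidean)
  show "second_countable (euclidean :: (int \<Rightarrow> real) topology)"
  proof -
    obtain B :: "(int \<Rightarrow> real) set set" where "countable B" and B: "topological_basis B"
      using ex_countable_basis by blast
    moreover have base: "\<exists>V\<in>B. x \<in> V \<and> V \<subseteq> U" if "open U" "x \<in> U" for U x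
      by (rule topological_basisE[OF B that]) blast
    ultimately show ?thesis
      unfolding second_countable_def using topological_basis_open[OF B]
      by (intro exI[of _ B] conjI ballI allI impI) (simp_all add: base)
  qed
  show "sets M = sigma_sets (topspace euclidean) {U. openin euclidean U}"
    by (simp add: sets_M sets_PiM_equal_borel sets_borel)
  show "inv_into (space M) (shift 1) \<in> measurable M M"
    by (simp add: inv_shift)
qed (simp_all add: prob_space_axioms bij_shift distr_shift)

text \<open>The slabs \<open>x 0 \<in> [i \<delta>, (i + 1) \<delta>]\<close> cover the space and have measure at most \<open>\<delta>\<close>, so for small \<open>\<delta>\<close> one
of them cuts a proper part of positive measure out of a given set.\<close>
lemma atomless_M: "atomless M"
  unfolding atomless_def
proof (intro ballI impI)
  fix A assume A[measurable]: "A \<in> sets M" and pos: "0 < measure M A"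
  define \<delta> where "\<delta> = measure M A / 2"
  have \<delta>: "0 < \<delta>" using pos by (simp add: \<delta>_def)
  define C where "C = (\<lambda>i::int. {x::int \<Rightarrow> real. x 0 \<in> {of_int i * \<delta>..of_int (i + 1) * \<delta>}})"
  have C_meas[measurable]: "C i \<in> sets M" for i
  proof -
    have "{x\<in>space M. x 0 \<in> {of_int i * \<delta>..of_int (i + 1) * \<delta>}} \<in> sets M" by measurable
    then show ?thesis by (simp add: C_def)
  qed
  have C_small: "measure M (C i) \<le> \<delta>" for i
  proof -
    have "emeasure M (C i) \<le> emeasure lborel {of_int i * \<delta>..of_int (i + 1) * \<delta>}"
      unfolding C_def by (rule coord_le_lborel) simp
    also have "\<dots> = ennreal \<delta>" using \<delta> by (simp add: algebra_simps)
    finally show ?thesis using \<delta> by (simp add: emeasure_eq_measure)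
  qed
  then have small: "measure M (A \<inter> C i) < measure M A" for i
  proof -
    have "measure M (A \<inter> C i) \<le> measure M (C i)" by (intro finite_measure_mono) auto
    also have "\<dots> \<le> \<delta>" by (rule C_small)
    also have "\<dots> < measure M A" using pos by (simp add: \<delta>_def)
    finally show ?thesis .
  qed
  have "\<exists>i. measure M (A \<inter> C i) \<noteq> 0"
  proof (rule ccontr)
    assume "\<nexists>i. measure M (A \<inter> C i) \<noteq> 0"
    then have "A \<inter> C i \<in> null_sets M" for i
      by (auto simp: null_sets_def emeasure_eq_measure)
    then have "(\<Union>i. A \<inter> C i) \<in> null_sets M"
      by (rule null_sets_UN)
    moreover have "(\<Union>i. A \<inter> C i) = A"
    proof -
      have "x \<in> C \<lfloor>x 0 / \<delta>\<rfloor>" for x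
      proof -
        have "of_int \<lfloor>x 0 / \<delta>\<rfloor> * \<delta> \<le> x 0"
          using pos_le_divide_eq[OF \<delta>, THEN iffD1, OF of_int_floor_le] .
        moreover have "x 0 \<le> of_int (\<lfloor>x 0 / \<delta>\<rfloor> + 1) * \<delta>"
          using pos_divide_less_eq[OF \<delta>, THEN iffD1, OF floor_correct[THEN conjunct2]]
          by (rule less_imp_le)
        ultimately show ?thesis by (simp add: C_def)
      qed
      then show ?thesis by blast
    qed
    ultimately show False using pos by (simp add: null_sets_def measure_def)
  qed
  then obtain i where "measure M (A \<inter> C i) \<noteq> 0" by blast
  with small[of i] show "\<exists>B\<in>sets M. B \<subseteq> A \<and> 0 < measure M B \<and> measure M B < measure M A"
    by (intro bexI[of _ "A \<inter> C i"]) (auto simp: zero_less_measure_iff)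
qed

end

section \<open>Fourier coefficients of sparse random sums\<close>

abbreviation e2pi :: "real \<Rightarrow> complex" where "e2pi t \<equiv> cis (2 * pi * t)"

lemma norm_e2pi_minus_1: "cmod (e2pi t - 1) \<le> 2 * pi * \<bar>t\<bar>"
  using iexp_approx1[of "2 * pi * t" 0] by (simp add: cis_conv_exp abs_mult)

text \<open>Let \<open>\<theta> = (\<Sum>i. \<epsilon> i * x i)\<close> with independent \<open>\<epsilon> i \<in> {0, 1}\<close> and \<open>P (\<epsilon> i = 1) = p i\<close>. The conditions on
\<open>p\<close> play opposite roles: \<open>p \<longlonglongrightarrow> 0\<close> makes a single summand \<open>\<epsilon> i * x i\<close> with large \<open>i\<close> negligible, and the
divergence of \<open>\<Sum>i. p i\<close> keeps the law of \<open>\<theta>\<close> free of atoms. The law itself is never formed; only its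
Fourier coefficients are used.\<close>
locale random_sum =
  fixes p x :: "nat \<Rightarrow> real"
  assumes p_pos: "0 < p i" and p_half: "p i \<le> 1 / 2" and p_decseq: "decseq p"
    and p_lim: "p \<longlonglongrightarrow> 0" and p_not_summable: "\<not> summable p"
    and x_pos: "0 < x i" and x_0: "x 0 \<le> 1 / 8" and x_Suc: "x (Suc i) \<le> x i / 16"
begin

text \<open>The Fourier coefficient at \<open>n\<close> of the law of \<open>\<epsilon> i * x i\<close>.\<close>
definition factor :: "nat \<Rightarrow> int \<Rightarrow> complex" where
  "factor i n = (1 - p i) + p i * e2pi (n * x i)"

text \<open>The Fourier coefficients of the law of \<open>\<theta>\<close>.\<close>
definition charfun :: "int \<Rightarrow> complex" where
  "charfun n = (\<Prod>i. factor i n)"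

lemma norm_factor_le_1: "cmod (factor i n) \<le> 1"
proof -
  have "cmod (factor i n) \<le> cmod (of_real (1 - p i)) + cmod (p i * e2pi (n * x i))"
    unfolding factor_def by (rule norm_triangle_ineq)
  also have "\<dots> = 1" using p_pos[of i] p_half[of i] by (simp add: norm_mult del: of_real_diff)
  finally show ?thesis .
qed

lemma factor_diff: "factor i m - factor i n = p i * (e2pi (m * x i) - e2pi (n * x i))"
  by (simp add: factor_def algebra_simps)

lemma x_geometric: "x i \<le> (1 / 16) ^ i / 8"
proof (induction i)
  case (Suc i)
  then show ?case using x_Suc[of i] by simp
qed (use x_0 in simp)

lemma summable_x: "summable x"
  by (rule summable_comparison_test'[where g="\<lambda>i. (1 / 16) ^ i / 8" and N=0])
     (use x_geometric x_pos in \<open>auto simp: less_imp_le intro!: summable_divide summable_geometric\<close>)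

lemma x_decseq: "decseq x"
proof (rule decseq_SucI)
  show "x (Suc i) \<le> x i" for i using x_Suc[of i] x_pos[of i] by simp
qed

lemma charfun_LIMSEQ: "(\<lambda>N. \<Prod>i\<le>N. factor i n) \<longlonglongrightarrow> charfun n"
proof -
  have "norm (factor i n - 1) \<le> 2 * pi * \<bar>real_of_int n\<bar> * x i" for i
  proof -
    have "norm (factor i n - 1) = p i * cmod (e2pi (n * x i) - 1)"
      using factor_diff[of i n 0] p_pos[of i] by (simp add: factor_def norm_mult)
    also have "\<dots> \<le> 1 * (2 * pi * \<bar>n * x i\<bar>)"
      using p_pos[of i] p_half[of i] by (intro mult_mono norm_e2pi_minus_1) auto
    finally show ?thesis using x_pos[of i] by (simp add: abs_mult)
  qed
  then have "summable (\<lambda>i. norm (factor i n - 1))"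
    by (intro summable_comparison_test'[OF summable_mult[OF summable_x], of 0]) simp
  then have "convergent_prod (\<lambda>i. factor i n)"
    by (intro abs_convergent_prod_imp_convergent_prod summable_imp_abs_convergent_prod)
  then show ?thesis unfolding charfun_def by (rule convergent_prod_LIMSEQ)
qed

lemma charfun_0: "charfun 0 = 1"
  unfolding charfun_def by (simp add: factor_def)

lemma charfun_uminus: "charfun (- n) = cnj (charfun n)"
proof (rule LIMSEQ_unique[OF charfun_LIMSEQ])
  have "factor i (- n) = cnj (factor i n)" for i
    by (simp add: factor_def cis_cnj)
  then show "(\<lambda>N. \<Prod>i\<le>N. factor i (- n)) \<longlonglongrightarrow> cnj (charfun n)"
    using tendsto_cnj[OF charfun_LIMSEQ[of n]] by simp
qed

text \<open>The product kernel with one more factor is a convex combination of the previous kernel and of its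
conjugate by the unimodular function \<open>m \<mapsto> e2pi (m * x N)\<close>, hence the induction over all complex
coefficient families.\<close>
lemma partial_product_psd:
  assumes F: "finite F"
  shows "0 \<le> Re (\<Sum>m\<in>F. \<Sum>n\<in>F. c m * cnj (c n) * (\<Prod>i<N. factor i (m - n)))"
proof (induction N arbitrary: c)
  case 0
  have "(\<Sum>m\<in>F. \<Sum>n\<in>F. c m * cnj (c n) * (\<Prod>i<0. factor i (m - n))) = (\<Sum>m\<in>F. c m) * cnj (\<Sum>n\<in>F. c n)"
    by (simp add: sum_product)
  also have "\<dots> = of_real ((cmod (\<Sum>m\<in>F. c m))\<^sup>2)"
    by (rule complex_norm_square[symmetric])
  finally show ?case by (simp only: Re_complex_of_real) simp
next
  case (Suc N)
  define P where "P = (\<lambda>k. \<Prod>i<N. factor i k)"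
  define d where "d = (\<lambda>m. c m * e2pi (m * x N))"
  have f: "factor N (m - n) = of_real (1 - p N) + of_real (p N) * (e2pi (m * x N) * cnj (e2pi (n * x N)))" for m n
    by (simp add: factor_def cis_cnj cis_mult algebra_simps)
  have "(\<Sum>m\<in>F. \<Sum>n\<in>F. c m * cnj (c n) * (\<Prod>i<Suc N. factor i (m - n))) =
     of_real (1 - p N) * (\<Sum>m\<in>F. \<Sum>n\<in>F. c m * cnj (c n) * P (m - n)) +
     of_real (p N) * (\<Sum>m\<in>F. \<Sum>n\<in>F. d m * cnj (d n) * P (m - n))"
    unfolding sum_distrib_left sum.distrib[symmetric]
    by (intro sum.cong refl) (simp add: f P_def d_def algebra_simps)
  then have "Re (\<Sum>m\<in>F. \<Sum>n\<in>F. c m * cnj (c n) * (\<Prod>i<Suc N. factor i (m - n))) =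
     (1 - p N) * Re (\<Sum>m\<in>F. \<Sum>n\<in>F. c m * cnj (c n) * P (m - n)) +
     p N * Re (\<Sum>m\<in>F. \<Sum>n\<in>F. d m * cnj (d n) * P (m - n))"
    by (simp only: plus_complex.sel Re_complex_of_real Im_complex_of_real times_complex.sel)
  also have "\<dots> \<ge> 0"
    using Suc[of c] Suc[of d] p_pos[of N] p_half[of N] unfolding P_def
    by (intro add_nonneg_nonneg mult_nonneg_nonneg) auto
  finally show ?case .
qed

lemma psd_kernel_charfun: "psd_kernel (\<lambda>m n. Re (charfun (m - n)))"
  unfolding psd_kernel_def
proof (intro conjI allI impI)
  show "Re (charfun (m - n)) = Re (charfun (n - m))" for m n
    using charfun_uminus[of "m - n"] by simp
  fix F :: "int set" and c :: "int \<Rightarrow> real" assume F: "finite F"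
  have "(\<lambda>N. \<Sum>m\<in>F. \<Sum>n\<in>F. c m * c n * Re (\<Prod>i\<le>N. factor i (m - n)))
      \<longlonglongrightarrow> (\<Sum>m\<in>F. \<Sum>n\<in>F. c m * c n * Re (charfun (m - n)))"
    by (intro tendsto_intros charfun_LIMSEQ)
  moreover have "0 \<le> (\<Sum>m\<in>F. \<Sum>n\<in>F. c m * c n * Re (\<Prod>i\<le>N. factor i (m - n)))" for N
    using partial_product_psd[OF F, of "\<lambda>m. complex_of_real (c m)" "Suc N"]
    by (simp add: lessThan_Suc_atMost mult.assoc)
  ultimately show "0 \<le> (\<Sum>m\<in>F. \<Sum>n\<in>F. c m * c n * Re (charfun (m - n)))"
    by (intro LIMSEQ_le_const) auto
qed

text \<open>The coefficient at \<open>n + k l\<close> differs from that at \<open>n\<close> by at most \<open>\<Sum>i. p i * b i l\<close>, where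
\<open>b i l = cmod (e2pi (k l * x i) - 1)\<close>. The terms with small \<open>i\<close> tend to zero as \<open>l\<close> grows; among
the others all but one are bounded by a geometric series, and the exceptional one is controlled only
through its probability \<open>p i\<close>, which is small because \<open>i\<close> is large.\<close>
lemma charfun_rigid:
  fixes k :: "nat \<Rightarrow> int"
  assumes lim: "\<And>i. (\<lambda>l. cmod (e2pi (k l * x i) - 1)) \<longlonglongrightarrow> 0"
    and single: "\<And>i j l. i < j \<Longrightarrow> (1 / 2) ^ i < cmod (e2pi (k l * x i) - 1) \<Longrightarrow> cmod (e2pi (k l * x j) - 1) \<le> (1 / 2) ^ j"
  shows "(\<lambda>l. charfun (n + k l)) \<longlonglongrightarrow> charfun n"
proof (rule LIMSEQ_I)
  fix \<epsilon> :: real assume \<epsilon>: "0 < \<epsilon>"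
  define b where "b = (\<lambda>i l. cmod (e2pi (k l * x i) - 1))"
  have b2: "b i l \<le> 2" for i l
    unfolding b_def using norm_triangle_ineq4[of "e2pi (k l * x i)" 1] by simp
  have "(\<lambda>K. 2 * p K) \<longlonglongrightarrow> 0" "(\<lambda>K. 2 * (1 / 2) ^ K :: real) \<longlonglongrightarrow> 0"
    using tendsto_mult_right_zero[OF p_lim, of 2]
      tendsto_mult_right_zero[OF LIMSEQ_power_zero[of "1/2 :: real"], of 2] by simp_all
  then have "\<forall>\<^sub>F K in sequentially. 2 * p K < \<epsilon> / 4 \<and> 2 * (1 / 2) ^ K < \<epsilon> / 4"
    using \<epsilon> by (intro eventually_conj order_tendstoD(2)[of _ 0]) auto
  then obtain K where K: "2 * p K < \<epsilon> / 4" "2 * (1 / 2) ^ K < \<epsilon> / 4"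
    unfolding eventually_sequentially by blast
  define \<eta> where "\<eta> = \<epsilon> / (4 * (real K + 1))"
  have \<eta>: "0 < \<eta>" "K * \<eta> \<le> \<epsilon> / 4"
    using \<epsilon> by (auto simp: \<eta>_def field_simps)
  have "\<forall>\<^sub>F l in sequentially. \<forall>i\<in>{..<K}. b i l < \<eta>"
    using order_tendstoD(2)[OF lim \<eta>(1)] unfolding b_def
    by (intro eventually_ball_finite) auto
  then obtain L where L: "\<And>l i. L \<le> l \<Longrightarrow> i < K \<Longrightarrow> b i l < \<eta>"
    unfolding eventually_sequentially by (meson lessThan_iff)
  have "norm (charfun (n + k l) - charfun n) < \<epsilon>" if l: "L \<le> l" for l
  proof -
    define large where "large = {i. K \<le> i \<and> (1 / 2) ^ i < b i l}"
    have large: "i = j" if "i \<in> large" "j \<in> large" for i j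
      using that single[of i j l] single[of j i l] unfolding large_def b_def
      by (cases i j rule: linorder_cases) auto
    have tail: "(\<Sum>i<N. if K \<le> i then (1 / 2) ^ i else 0) = (if N \<le> K then 0 else 2 * (1 / 2) ^ K - 2 * (1 / 2 :: real) ^ N)" for N
      by (induction N) (auto simp: not_less_eq_eq dest: le_antisym)
    have "norm ((\<Prod>i\<le>N. factor i (n + k l)) - (\<Prod>i\<le>N. factor i n)) \<le> 3 / 4 * \<epsilon>" for N
    proof -
      have "norm ((\<Prod>i\<le>N. factor i (n + k l)) - (\<Prod>i\<le>N. factor i n)) \<le> (\<Sum>i\<le>N. norm (factor i (n + k l) - factor i n))"
        by (rule norm_prod_diff) (auto intro: norm_factor_le_1)
      also have "\<dots> = (\<Sum>i\<le>N. p i * b i l)"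
      proof (intro sum.cong refl)
        fix i
        have "e2pi ((n + k l) * x i) = e2pi (n * x i) * e2pi (k l * x i)"
          by (simp add: cis_mult algebra_simps)
        then have "e2pi ((n + k l) * x i) - e2pi (n * x i) = e2pi (n * x i) * (e2pi (k l * x i) - 1)"
          by (simp add: algebra_simps)
        then show "norm (factor i (n + k l) - factor i n) = p i * b i l"
          unfolding factor_diff b_def using p_pos[of i] by (simp add: norm_mult)
      qed
      also have "\<dots> \<le> (\<Sum>i\<le>N. (if i < K then \<eta> else 0) + (if K \<le> i then (1 / 2) ^ i else 0) + (if i \<in> large then 2 * p K else 0))"
      proof (rule sum_mono)
        fix i
        have p1: "p i * b i l \<le> b i l"
          using p_pos[of i] p_half[of i] by (intro mult_left_le_one_le) (auto simp: b_def)
        show "p i * b i l \<le> (if i < K then \<eta> else 0) + (if K \<le> i then (1 / 2) ^ i else 0) + (if i \<in> large then 2 * p K else 0)"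
        proof (cases "i < K")
          case True
          then show ?thesis using L[OF l True] p1 p_pos[of K] by auto
        next
          case False
          then have "p i \<le> p K" using p_decseq by (auto simp: decseq_def)
          then have "p i * b i l \<le> p K * 2"
            using b2[of i l] p_pos[of K] by (intro mult_mono) (auto simp: b_def)
          with False p1 show ?thesis by (auto simp: large_def not_less intro: order_trans add_increasing)
        qed
      qed
      also have "\<dots> = (\<Sum>i\<le>N. if i < K then \<eta> else 0) + (\<Sum>i\<le>N. if K \<le> i then (1 / 2) ^ i else 0) + (\<Sum>i\<le>N. if i \<in> large then 2 * p K else 0)"
        by (simp add: sum.distrib)
      also have "\<dots> \<le> \<epsilon> / 4 + \<epsilon> / 4 + \<epsilon> / 4"
      proof (intro add_mono)
        have "(\<Sum>i\<le>N. if i < K then \<eta> else 0) = card {i. i \<le> N \<and> i < K} * \<eta>"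
          by (simp add: sum.If_cases Int_def)
        also have "card {i. i \<le> N \<and> i < K} \<le> card {..<K}"
          by (intro card_mono) auto
        finally show "(\<Sum>i\<le>N. if i < K then \<eta> else 0) \<le> \<epsilon> / 4"
          using \<eta> by (auto intro: order_trans)
        have sum_tail: "(\<Sum>i\<le>N. if K \<le> i then (1 / 2) ^ i else 0) =
            (if Suc N \<le> K then 0 else 2 * (1 / 2) ^ K - 2 * (1 / 2 :: real) ^ Suc N)"
          using tail[of "Suc N"] by (simp only: lessThan_Suc_atMost)
        have "0 \<le> (1 / 2 :: real) ^ Suc N" by simp
        with K(2) \<epsilon> show "(\<Sum>i\<le>N. if K \<le> i then (1 / 2) ^ i else 0) \<le> \<epsilon> / 4"
          unfolding sum_tail by (cases "Suc N \<le> K"; simp only: if_True if_False; linarith)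
        have "finite ({..N} \<inter> large)" "card ({..N} \<inter> large) \<le> Suc 0"
          using large by (auto simp: card_le_Suc0_iff_eq)
        then have "(\<Sum>i\<le>N. if i \<in> large then 2 * p K else 0) \<le> 1 * (2 * p K)"
          using p_pos[of K] by (simp add: sum.If_cases del: mult_1)
        then show "(\<Sum>i\<le>N. if i \<in> large then 2 * p K else 0) \<le> \<epsilon> / 4"
          using K(1) by simp
      qed
      finally show ?thesis by simp
    qed
    moreover have "(\<lambda>N. norm ((\<Prod>i\<le>N. factor i (n + k l)) - (\<Prod>i\<le>N. factor i n))) \<longlonglongrightarrow> norm (charfun (n + k l) - charfun n)"
      by (intro tendsto_intros charfun_LIMSEQ)
    ultimately have "norm (charfun (n + k l) - charfun n) \<le> 3 / 4 * \<epsilon>"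
      by (intro LIMSEQ_le_const2) auto
    then show ?thesis using \<epsilon> by simp
  qed
  then show "\<exists>L. \<forall>l\<ge>L. norm (charfun (n + k l) - charfun n) < \<epsilon>" by blast
qed

lemma half_integer_point:
  fixes u w :: real
  assumes w: "0 < w"
  obtains t and h :: int where "u \<le> t" "t \<le> u + 1 / w" "t * w = h + 1 / 2"
proof -
  define h where "h = \<lceil>u * w - 1 / 2\<rceil>"
  have h: "u * w \<le> h + 1 / 2" "h + 1 / 2 \<le> u * w + 1"
    using ceiling_correct[of "u * w - 1 / 2"] unfolding h_def by linarith+
  have "u = (u * w) / w" "u + 1 / w = (u * w + 1) / w" using w by (simp_all add: field_simps)
  then have "u \<le> (h + 1 / 2) / w" "(h + 1 / 2) / w \<le> u + 1 / w"
    using divide_right_mono[OF h(1), of w] divide_right_mono[OF h(2), of w] w by linarith+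
  then show thesis
    using w by (intro that[of "(h + 1 / 2) / w" h]) simp_all
qed

text \<open>The frequencies decrease so fast that a window in which \<open>n * x (i + 1)\<close> stays close to a
half-integer contains a full period of \<open>n * x i\<close>. So the frequencies can be handled one after the other,
from the smallest to the largest, inside nested windows.\<close>
lemma half_integer_approximation:
  "\<exists>n::int. u \<le> n \<and> n \<le> u + 2 / x (a + d) \<and>
     (\<forall>i\<in>{a..a + d}. \<exists>h::int. \<bar>n * x i - h - 1 / 2\<bar> \<le> 1 / 8)"
proof (induction d arbitrary: u)
  case 0
  obtain t and h :: int where t: "u \<le> t" "t \<le> u + 1 / x a" "t * x a = h + 1 / 2"
    using half_integer_point[OF x_pos] .
  have "x a \<le> 1 / 8" using x_decseq x_0 by (metis decseq_def le0 order_trans)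
  then have "1 \<le> 1 / x a" using x_pos[of a] by (simp add: pos_le_divide_eq)
  moreover have "\<bar>\<lceil>t\<rceil> * x a - h - 1 / 2\<bar> \<le> 1 / 8"
  proof -
    have "\<lceil>t\<rceil> * x a - h - 1 / 2 = (\<lceil>t\<rceil> - t) * x a"
      using t(3) by (simp add: algebra_simps)
    also have "\<bar>\<dots>\<bar> \<le> 1 * x a"
      unfolding abs_mult using x_pos[of a] ceiling_correct[of t] by (intro mult_mono) auto
    finally show ?thesis using \<open>x a \<le> 1 / 8\<close> by simp
  qed
  ultimately show ?case
    using t ceiling_correct[of t] le_of_int_ceiling[of t]
    by (intro exI[of _ "\<lceil>t\<rceil>"] conjI) (auto simp del: le_of_int_ceiling)
next
  case (Suc d)
  let ?b = "a + Suc d"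
  obtain t and h :: int where t: "u \<le> t" "t \<le> u + 1 / x ?b" "t * x ?b = h + 1 / 2"
    using half_integer_point[OF x_pos] .
  obtain n :: int where n: "t \<le> n" "n \<le> t + 2 / x (a + d)"
    "\<And>i. i \<in> {a..a + d} \<Longrightarrow> \<exists>h::int. \<bar>n * x i - h - 1 / 2\<bar> \<le> 1 / 8"
    using Suc.IH[of t] by blast
  have x: "x ?b \<le> x (a + d) / 16" "0 < x ?b" "0 < x (a + d)"
    using x_Suc[of "a + d"] x_pos by auto
  have "2 / x (a + d) \<le> 1 / x ?b"
    using x by (simp add: field_simps)
  then have "u \<le> n" "n \<le> u + 2 / x ?b" using n t by auto
  moreover have "\<bar>n * x ?b - h - 1 / 2\<bar> \<le> 1 / 8"
  proof -
    have "n * x ?b - h - 1 / 2 = (n - t) * x ?b"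
      using t(3) by (simp add: algebra_simps)
    also have "\<bar>\<dots>\<bar> \<le> (2 / x (a + d)) * (x (a + d) / 16)"
      unfolding abs_mult using x n by (intro mult_mono) auto
    finally show ?thesis using x by simp
  qed
  ultimately show ?case
    using n(3) by (intro exI[of _ n]) (auto simp: le_Suc_eq)
qed

text \<open>Near a half-integer the exponential has nonpositive real part, so the factor is strictly
contracting by an amount proportional to \<open>p i\<close>.\<close>
lemma norm_factor_near_half:
  fixes n h :: int
  assumes "\<bar>n * x i - h - 1 / 2\<bar> \<le> 1 / 4"
  shows "cmod (factor i n) \<le> exp (- p i / 2)"
proof -
  define s where "s = n * x i - h - 1 / 2"
  define y where "y = 2 * pi * (n * x i)"
  have "y = 2 * pi * h + (pi + 2 * pi * s)"
    by (simp add: y_def s_def algebra_simps)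
  then have "cos y = cos (pi + 2 * pi * s)"
    using cos_int_2pin[of h] sin_int_2pin[of h] by (simp only: cos_add) simp
  also have "\<dots> = - cos (2 * pi * s)"
    by (simp add: cos_add)
  finally have "cos y = - cos (2 * pi * s)" .
  moreover have "\<bar>2 * pi * s\<bar> \<le> pi / 2"
    using assms unfolding s_def[symmetric] by (simp add: abs_mult)
  then have "0 \<le> cos (2 * pi * s)" by (intro cos_ge_zero) linarith+
  ultimately have cos: "cos y \<le> 0" by linarith
  have "(cmod (factor i n))\<^sup>2 = (1 - p i + p i * cos y)\<^sup>2 + (p i * sin y)\<^sup>2"
    by (simp add: factor_def cmod_power2 y_def mult.assoc)
  also have "\<dots> = (1 - p i)\<^sup>2 + 2 * (1 - p i) * p i * cos y + (p i)\<^sup>2 * ((cos y)\<^sup>2 + (sin y)\<^sup>2)"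
    by algebra
  also have "\<dots> \<le> (1 - p i)\<^sup>2 + (p i)\<^sup>2"
    using cos p_pos[of i] p_half[of i] by (simp add: mult_nonneg_nonpos)
  also have "\<dots> \<le> 1 - p i"
  proof -
    have "p i * p i \<le> p i * (1 / 2)" using p_pos[of i] p_half[of i] by (intro mult_left_mono) auto
    then show ?thesis by (simp add: power2_eq_square algebra_simps)
  qed
  also have "\<dots> \<le> exp (- p i)" using exp_ge_add_one_self[of "- p i"] by simp
  also have "\<dots> = (exp (- p i / 2))\<^sup>2" by (simp add: power2_eq_square exp_add[symmetric])
  finally show ?thesis by (rule power2_le_imp_le) simp
qed

text \<open>Choose a block \<open>a..a + d\<close> of indices so far out that adding \<open>k\<close> with \<open>\<bar>k\<bar> \<le> K\<close> to a
time \<open>n\<close> changes \<open>n * x i\<close> by at most \<open>1 / 8\<close>, and so long that \<open>\<Sum>i. p i\<close> over the block is large.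
At a time \<open>n\<close> that brings all \<open>n * x i\<close> of the block close to half-integers, the factors of the
block alone make the product small.\<close>
lemma charfun_small_window:
  assumes "0 < \<epsilon>"
  shows "\<exists>n::nat. \<forall>k. \<bar>k\<bar> \<le> int K \<longrightarrow> cmod (charfun (k + int n)) \<le> \<epsilon>"
proof -
  have "(\<lambda>i. K * x i) \<longlonglongrightarrow> 0"
    using tendsto_mult_right_zero[OF summable_LIMSEQ_zero[OF summable_x]] .
  then have "\<forall>\<^sub>F i in sequentially. K * x i < 1 / 8"
    by (rule order_tendstoD) simp
  then obtain a where a: "\<And>i. a \<le> i \<Longrightarrow> K * x i < 1 / 8"
    unfolding eventually_sequentially by blast
  have "\<exists>d. - 2 * ln \<epsilon> < (\<Sum>i\<le>d. p (i + a))"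
  proof (rule ccontr)
    assume "\<not> ?thesis"
    then have "summable (\<lambda>i. p (i + a))"
      using p_pos by (intro bounded_imp_summable[where B="- 2 * ln \<epsilon>"]) (auto simp: not_less less_imp_le)
    then show False using p_not_summable by simp
  qed
  then obtain d where d: "- 2 * ln \<epsilon> < (\<Sum>i\<le>d. p (i + a))" by blast
  obtain n :: int where n: "0 \<le> n" "\<And>i. i \<in> {a..a + d} \<Longrightarrow> \<exists>h::int. \<bar>n * x i - h - 1 / 2\<bar> \<le> 1 / 8"
    using half_integer_approximation[of 0 a d] by auto
  have "cmod (charfun (k + n)) \<le> \<epsilon>" if k: "\<bar>k\<bar> \<le> int K" for k
  proof -
    have small: "cmod (factor i (k + n)) \<le> exp (- p i / 2)" if i: "i \<in> {a..a + d}" for i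
    proof -
      obtain h :: int where h: "\<bar>n * x i - h - 1 / 2\<bar> \<le> 1 / 8" using n(2)[OF i] by blast
      have "\<bar>k * x i\<bar> \<le> K * x i"
        unfolding abs_mult using k x_pos[of i] by (intro mult_mono) auto
      then have "\<bar>k * x i\<bar> \<le> 1 / 8" using a[of i] i by simp
      with h have "\<bar>(k + n) * x i - h - 1 / 2\<bar> \<le> 1 / 4"
        unfolding of_int_add distrib_right by linarith
      then show ?thesis by (rule norm_factor_near_half)
    qed
    have "cmod (\<Prod>i\<le>N. factor i (k + n)) \<le> \<epsilon>" if N: "a + d \<le> N" for N
    proof -
      have "cmod (\<Prod>i\<le>N. factor i (k + n)) =
          (\<Prod>i\<in>{..N} - {a..a + d}. cmod (factor i (k + n))) * (\<Prod>i\<in>{a..a + d}. cmod (factor i (k + n)))"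
        unfolding prod_norm[symmetric] using N by (intro prod.subset_diff) auto
      also have "\<dots> \<le> 1 * (\<Prod>i\<in>{a..a + d}. exp (- p i / 2))"
        by (intro mult_mono prod_le_1 prod_mono)
             (use small in \<open>auto intro: prod_nonneg norm_factor_le_1\<close>)
      also have "\<dots> = exp (- (\<Sum>i\<in>{a..a + d}. p i) / 2)"
        by (simp add: exp_sum[symmetric] sum_negf sum_divide_distrib)
      also have "(\<Sum>i\<in>{a..a + d}. p i) = (\<Sum>i\<le>d. p (i + a))"
        using sum.shift_bounds_cl_nat_ivl[of p 0 a d] by (simp add: atMost_atLeast0 add.commute)
      also have "exp (- (\<Sum>i\<le>d. p (i + a)) / 2) \<le> exp (ln \<epsilon>)"
        using d by simp
      finally show ?thesis using assms by simp
    qed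
    then show ?thesis
      by (intro LIMSEQ_le_const2[OF tendsto_norm[OF charfun_LIMSEQ]]) blast
  qed
  with n(1) show ?thesis
    by (intro exI[of _ "nat n"]) auto
qed

lemma charfun_decay:
  obtains k :: "nat \<Rightarrow> nat" where "\<And>n. (\<lambda>j. charfun (n + int (k j))) \<longlonglongrightarrow> 0"
proof -
  have "\<forall>j. \<exists>k::nat. \<forall>n. \<bar>n\<bar> \<le> int j \<longrightarrow> cmod (charfun (n + int k)) \<le> 1 / (real j + 1)"
    using charfun_small_window by simp
  then obtain k :: "nat \<Rightarrow> nat" where k: "\<And>j n. \<bar>n\<bar> \<le> int j \<Longrightarrow> cmod (charfun (n + int (k j))) \<le> 1 / (real j + 1)"
    by metis
  have "(\<lambda>j. charfun (n + int (k j))) \<longlonglongrightarrow> 0" for n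
  proof (rule Lim_null_comparison)
    show "\<forall>\<^sub>F j in sequentially. cmod (charfun (n + int (k j))) \<le> 1 / (real j + 1)"
      using k unfolding eventually_sequentially by (intro exI[of _ "nat \<bar>n\<bar>"]) auto
    show "(\<lambda>j. 1 / (real j + 1)) \<longlonglongrightarrow> 0"
      using LIMSEQ_inverse_real_of_nat by (simp add: inverse_eq_divide add.commute)
  qed
  then show thesis by (rule that)
qed

end

section \<open>Frequencies that are rarely visible\<close>

lemma small_integer_combination:
  fixes \<alpha> \<delta> :: real
  assumes "\<alpha> \<notin> \<rat>" "0 < \<delta>"
  obtains k h :: int where "0 < k * \<alpha> - h" "k * \<alpha> - h < \<delta>"
proof -
  obtain N :: nat where N: "0 < N" "1 / N < \<delta>"
    using reals_Archimedean[OF assms(2)] by (auto simp: inverse_eq_divide intro: that[of "Suc _"])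
  obtain h k :: int where hk: "0 < k" "\<bar>k * \<alpha> - h\<bar> < 1 / N"
    using Dirichlet_approx[OF N(1)] by metis
  have "k * \<alpha> - h \<noteq> 0"
  proof
    assume "k * \<alpha> - h = 0"
    then have "\<alpha> = h / k" using hk(1) by (simp add: field_simps)
    then show False using assms(1) by simp
  qed
  then show thesis
    using hk N that[of k h] that[of "- k" "- h"] by (cases "0 < k * \<alpha> - h") auto
qed

text \<open>Replacing \<open>t\<close> by \<open>t - n\<close> with an integer \<open>n\<close> changes \<open>k * t - h\<close> by an integer.\<close>
lemma norm_e2pi_minus_1_le_dist_int:
  fixes k h :: int and t :: real
  shows "cmod (e2pi (k * t - h) - 1) \<le> 2 * pi * \<bar>k\<bar> * dist_int t"
proof (cases "k = 0")
  case True
  have "e2pi (- h) = 1" by (rule cis_multiple_2pi) simp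
  then show ?thesis using True by simp
next
  case False
  have "cmod (e2pi (k * t - h) - 1) / (2 * pi * \<bar>k\<bar>) \<le> \<bar>t - n\<bar>" for n :: int
  proof -
    have "e2pi (k * t - h) = e2pi (k * (t - n)) * e2pi (k * n - h)"
      by (simp add: cis_mult algebra_simps)
    also have "e2pi (k * n - h) = 1"
      by (rule cis_multiple_2pi) simp
    finally have "cmod (e2pi (k * t - h) - 1) \<le> 2 * pi * \<bar>k * (t - n)\<bar>"
      using norm_e2pi_minus_1[of "k * (t - n)"] by simp
    then show ?thesis using False by (simp add: abs_mult pos_divide_le_eq mult_ac)
  qed
  then have "cmod (e2pi (k * t - h) - 1) / (2 * pi * \<bar>k\<bar>) \<le> dist_int t"
    unfolding dist_int_def by (intro cINF_greatest) auto
  then show ?thesis using False by (simp add: pos_divide_le_eq mult_ac)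
qed

text \<open>Call \<open>x i\<close> visible at the time \<open>m l\<close> if \<open>cmod (e2pi (m l * x i) - 1)\<close> exceeds \<open>(1 / 2) ^ i\<close>. All
frequencies are integer combinations of \<open>\<alpha>\<close> and \<open>1\<close>, so each of them is visible at finitely many
times only. When \<open>x j\<close> is chosen, the times at which one of the earlier frequencies is
visible therefore form a finite set, and \<open>x j\<close> can be taken so small that it is invisible at those
times. Hence at every time at most one frequency is visible.\<close>
lemma frequency_sequence_exists:
  fixes \<alpha> :: real and m :: "nat \<Rightarrow> int"
  assumes \<alpha>: "\<alpha> \<notin> \<rat>" and m: "(\<lambda>l. dist_int (m l * \<alpha>)) \<longlonglongrightarrow> 0"
  obtains x :: "nat \<Rightarrow> real" where
    "\<And>i. 0 < x i" "x 0 \<le> 1 / 8" "\<And>i. x (Suc i) \<le> x i / 16"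
    "\<And>i. (\<lambda>l. cmod (e2pi (m l * x i) - 1)) \<longlonglongrightarrow> 0"
    "\<And>i j l. i < j \<Longrightarrow> (1 / 2) ^ i < cmod (e2pi (m l * x i) - 1) \<Longrightarrow> cmod (e2pi (m l * x j) - 1) \<le> (1 / 2) ^ j"
proof -
  define b :: "real \<Rightarrow> nat \<Rightarrow> real" where "b = (\<lambda>(r::real) l. cmod (e2pi (m l * r) - 1))"
  have b_lim: "b (k * \<alpha> - h) \<longlonglongrightarrow> 0" for k h :: int
  proof (rule Lim_null_comparison)
    have "norm (b (k * \<alpha> - h) l) \<le> 2 * pi * \<bar>k\<bar> * dist_int (m l * \<alpha>)" for l
      using norm_e2pi_minus_1_le_dist_int[where k=k and h="m l * h" and t="real_of_int (m l) * \<alpha>"]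
      by (simp add: b_def algebra_simps)
    then show "\<forall>\<^sub>F l in sequentially. norm (b (k * \<alpha> - h) l) \<le> 2 * pi * \<bar>k\<bar> * dist_int (m l * \<alpha>)"
      by simp
    show "(\<lambda>l. 2 * pi * \<bar>k\<bar> * dist_int (m l * \<alpha>)) \<longlonglongrightarrow> 0"
      using m by (rule tendsto_mult_right_zero)
  qed
  define P where "P = (\<lambda>(f :: nat \<Rightarrow> real) i r. (\<exists>(k::int) (h::int). r = k * \<alpha> - h) \<and> 0 < r \<and> r \<le> 1 / 8 \<and>
      (\<forall>j<i. r \<le> f j / 16) \<and> (\<forall>j<i. \<forall>l. (1 / 2) ^ j < b (f j) l \<longrightarrow> b r l \<le> (1 / 2) ^ i))"
  have "\<exists>x. \<forall>i. P x i (x i)"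
  proof (rule dependent_wellorder_choice)
    show "P f i r = P g i r" if "\<And>j. j < i \<Longrightarrow> f j = g j" for r f g i
      using that by (auto simp: P_def)
    fix i and f :: "nat \<Rightarrow> real" assume f: "\<And>j. j < i \<Longrightarrow> P f j (f j)"
    define B where "B = (\<Union>j<i. {l. (1 / 2) ^ j < b (f j) l})"
    have "finite {l. (1 / 2) ^ j < b (f j) l}" if "j < i" for j
    proof -
      have "b (f j) \<longlonglongrightarrow> 0" using f[OF that] b_lim by (auto simp: P_def)
      then have "\<forall>\<^sub>F l in sequentially. b (f j) l < (1 / 2) ^ j"
        by (rule order_tendstoD) simp
      then obtain L where "\<And>l. L \<le> l \<Longrightarrow> b (f j) l < (1 / 2) ^ j"
        unfolding eventually_sequentially by blast
      then have "{l. (1 / 2) ^ j < b (f j) l} \<subseteq> {..<L}"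
        by (auto simp: not_less[symmetric] dest: order.asym)
      then show ?thesis by (rule finite_subset) simp
    qed
    then have B: "finite B" unfolding B_def by blast
    \<comment> \<open>At the times in \<open>B\<close>, a frequency below \<open>(1 / 2) ^ i / (2 * pi * S)\<close> is invisible.\<close>
    define S where "S = 1 + (\<Sum>l\<in>B. \<bar>real_of_int (m l)\<bar>)"
    have S: "0 < S" "\<And>l. l \<in> B \<Longrightarrow> \<bar>m l\<bar> \<le> S"
      using B member_le_sum[of _ B "\<lambda>l. \<bar>real_of_int (m l)\<bar>"]
      by (auto simp: S_def intro!: add_pos_nonneg sum_nonneg intro: add_increasing)
    define D where "D = insert (1 / 8) (insert ((1 / 2) ^ i / (2 * pi * S)) ((\<lambda>j. f j / 16) ` {..<i}))"
    have D: "finite D" "D \<noteq> {}" "\<And>d. d \<in> D \<Longrightarrow> 0 < d"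
      using S f by (auto simp: D_def P_def)
    then have "0 < Min D" by simp
    then obtain k h :: int where r: "0 < k * \<alpha> - h" "k * \<alpha> - h < Min D"
      using small_integer_combination[OF \<alpha>] by metis
    define r where "r = k * \<alpha> - h"
    have r_less: "r < d" if "d \<in> D" for d
      using r(2) D that by (simp add: r_def)
    have "b r l \<le> (1 / 2) ^ i" if "l \<in> B" for l
    proof -
      have "b r l \<le> 2 * pi * \<bar>m l * r\<bar>" unfolding b_def by (rule norm_e2pi_minus_1)
      also have "\<dots> \<le> 2 * pi * (S * ((1 / 2) ^ i / (2 * pi * S)))"
        unfolding abs_mult using S(1) S(2)[OF that] r(1) r_less[of "(1 / 2) ^ i / (2 * pi * S)"]
        by (intro mult_left_mono mult_mono) (auto simp: r_def D_def)
      finally show ?thesis using S(1) by simp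
    qed
    then have "\<forall>j<i. \<forall>l. (1 / 2) ^ j < b (f j) l \<longrightarrow> b r l \<le> (1 / 2) ^ i"
      unfolding B_def by blast
    moreover have "r \<le> 1 / 8" "\<forall>j<i. r \<le> f j / 16"
      using less_imp_le[OF r_less] unfolding D_def by blast+
    moreover have "0 < r" "\<exists>(k::int) (h::int). r = k * \<alpha> - h"
      using r(1) unfolding r_def by blast+
    ultimately have "P f i r" unfolding P_def by blast
    then show "\<exists>r. P f i r" ..
  qed
  then obtain x where x: "\<And>i. P x i (x i)" by blast
  show thesis
  proof (rule that[of x])
    show "0 < x i" "x 0 \<le> 1 / 8" "x (Suc i) \<le> x i / 16" for i
      using x[of i] x[of 0] x[of "Suc i"] by (auto simp: P_def)
    show "(\<lambda>l. cmod (e2pi (m l * x i) - 1)) \<longlonglongrightarrow> 0" for i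
      using x[of i] b_lim by (auto simp: P_def b_def)
    show "cmod (e2pi (m l * x j) - 1) \<le> (1 / 2) ^ j"
      if "i < j" "(1 / 2) ^ i < cmod (e2pi (m l * x i) - 1)" for i j l
      using x[of j] that by (auto simp: P_def b_def)
  qed
qed

theorem corollary1:
  fixes \<alpha> :: real and m :: "nat \<Rightarrow> int"
  assumes "\<alpha> \<notin> \<rat>"
    and "(\<lambda>l. dist_int (of_int (m l) * \<alpha>)) \<longlonglongrightarrow> 0"
  shows "\<exists>(M :: (int \<Rightarrow> real) measure) T.
           dynamical_system T M \<and> atomless M \<and> weakly_mixing T M \<and> rigidity_sequence m T M"
proof -
  obtain x :: "nat \<Rightarrow> real" where x: "\<And>i. 0 < x i" "x 0 \<le> 1 / 8" "\<And>i. x (Suc i) \<le> x i / 16"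
    and x_lim: "\<And>i. (\<lambda>l. cmod (e2pi (m l * x i) - 1)) \<longlonglongrightarrow> 0"
    and x_single: "\<And>i j l. i < j \<Longrightarrow> (1 / 2) ^ i < cmod (e2pi (m l * x i) - 1) \<Longrightarrow> cmod (e2pi (m l * x j) - 1) \<le> (1 / 2) ^ j"
    by (rule frequency_sequence_exists[OF assms]) blast
  \<comment> \<open>These probabilities tend to zero, but their sum, the harmonic series, diverges.\<close>
  define p :: "nat \<Rightarrow> real" where "p = (\<lambda>i. inverse (real (Suc (Suc i))))"
  interpret random_sum p x
  proof
    show "decseq p" unfolding p_def by (auto simp: decseq_def)
    show "p \<longlonglongrightarrow> 0"
      unfolding p_def by (rule LIMSEQ_Suc[OF LIMSEQ_inverse_real_of_nat])
    show "\<not> summable p"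
      unfolding p_def using not_summable_harmonic[where 'a=real]
      by (subst summable_Suc_iff[of "\<lambda>i. inverse (real (Suc i))"], subst summable_Suc_iff)
    show "0 < p i" "p i \<le> 1 / 2" for i
      by (simp_all add: p_def field_simps)
  qed (use x in auto)
  obtain M where M: "gaussian_law M (\<lambda>m n. Re (charfun (m - n)))"
    using gaussian_measure_exists[OF psd_kernel_charfun] .
  interpret gaussian_shift M "\<lambda>n. Re (charfun n)"
    by standard (use M in \<open>simp_all add: charfun_uminus charfun_0\<close>)
  obtain k :: "nat \<Rightarrow> nat" where k: "\<And>n. (\<lambda>j. charfun (n + int (k j))) \<longlonglongrightarrow> 0"
    using charfun_decay by blast
  have "weakly_mixing (shift 1) M"
    using tendsto_Re[OF k] by (intro weakly_mixing_shift[of k]) simp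
  moreover have "rigidity_sequence m (shift 1) M"
    using x_lim x_single by (intro rigidity_sequence_shift tendsto_Re charfun_rigid)
  ultimately show ?thesis
     using dynamical_system_shift atomless_M by blast
qed

end
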